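(* Let $U:\mathbb{R}^d\to\mathbb{R}$ be continuously differentiable, and let $L\ge 0$, $m>0$ be such that for all $x,y\in\mathbb{R}^d$, $\|\nabla U(x)-\nabla U(y)\|\le L\|x-y\|$ and $U(y)\ge U(x)+\langle\nabla U(x),y-x\rangle+(m/2)\|x-y\|^2$. (i) Let $(\gamma_k)_{k\ge1}$ be a non-increasing sequence of positive real numbers with $\gamma_1\le 2/(m+L)$. Then for all $x,y\in\mathbb{R}^d$ and integers $1\le n<\ell$, $$\|\delta_xQ_\gamma^{n,\ell}-\delta_yQ_\gamma^{n,\ell}\|_{\mathrm{TV}}\le 1-2\mathbf{\Phi}\left\{-\|x-y\|/\{8\,\Lambda_{n,\ell}(\gamma)\}^{1/2}\right\}.$$ (ii) Let $(\gamma_k)_{k\ge1}$ be a non-increasing sequence of positive real numbers with $\gamma_1\le 2/(m+L)$. Then for all probability measures $\mu,\nu$ on $\mathbb{R}^d$ with finite first moment and integers $1\le n<\ell$, $$\|\mu Q_\gamma^{n,\ell}-\nu Q_\gamma^{n,\ell}\|_{\mathrm{TV}}\le\{4\pi_0\Lambda_{n,\ell}(\gamma)\}^{-1/2}W_1(\mu,\nu),$$ where $\pi_0=3.14159\ldots$ is the circle constant. (iii) Let $\gamma\in(0,2/(m+L)]$. Then for any $x\in\mathbb{R}^d$ and $n\ge1$, $$\|\pi_\gamma-\delta_xR_\gamma^n\|_{\mathrm{TV}}\le\{4\pi_0\kappa^{-1}(1-(1-\kappa\gamma)^{n/2})\}^{-1/2}(1-\kappa\gamma)^{n/2}\left\{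\|x-x^\star\|+(2\kappa^{-1}d)^{1/2}\right\}.$$
   Context: Here $d\ge1$ and $\|\cdot\|$ is the Euclidean norm. $x^\star$ is the unique minimizer of $U$ and $\kappa=2mL/(m+L)$. For $\gamma>0$, $R_\gamma$ is the Markov kernel on $\mathbb{R}^d$ such that $R_\gamma(x,\cdot)$ is the Gaussian distribution with mean $x-\gamma\nabla U(x)$ and covariance matrix $2\gamma I_d$; for $\gamma\le2/(m+L)$ it has a unique stationary distribution, denoted $\pi_\gamma$. For $1\le n\le\ell$, $Q_\gamma^{n,\ell}=R_{\gamma_n}\cdots R_{\gamma_\ell}$ and $$\Lambda_{n,\ell}(\gamma)=\kappa^{-1}\left\{\prod_{j=n}^\ell(1-\kappa\gamma_j)^{-1}-1\right\},$$ with the convention that $\Lambda_{n,\ell}(\gamma)=+\infty$ (and division by $+\infty$ gives $0$) if some $\kappa\gamma_j=1$. $\mathbf{\Phi}$ is the cumulative distribution function of the standard normal law. $\|\mu-\nu\|_{\mathrm{TV}}=\sup_A|\mu(A)-\nu(A)|$ over Borel sets $A$. $W_1$ is the Wasserstein distance of order $1$ associated with the Euclidean distance. *)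

theory Defs
  imports "HOL-Probability.Probability"
begin

text \<open>
  Isotropic Gaussian law with mean \<open>\<mu>\<close> and covariance matrix \<open>v \<cdot> I\<close> (meaningful for \<open>v > 0\<close>), given
  by its Lebesgue density.
\<close>

definition iso_gaussian :: "'a::euclidean_space \<Rightarrow> real \<Rightarrow> 'a measure" where
  "iso_gaussian \<mu> v = density lborel
     (\<lambda>y. ennreal ((2 * pi * v) powr (- real DIM('a) / 2) * exp (- (norm (y - \<mu>))\<^sup>2 / (2 * v))))"

definition ula_kernel :: "('a::euclidean_space \<Rightarrow> 'a) \<Rightarrow> real \<Rightarrow> 'a \<Rightarrow> 'a measure" where
  "ula_kernel gradU g x = iso_gaussian (x - g *\<^sub>R gradU x) (2 * g)"

text \<open>
  Kernels are composed in diagrammatic order: \<open>(K K')(x, A) = \<integral> K'(y, A) K(x, dy)\<close>. The action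
  \<open>\<mu> K\<close> of a kernel on a measure is \<^const>\<open>bind\<close> of the Giry monad, and \<open>return borel\<close> is both the
  identity kernel and the map \<open>x \<mapsto> \<delta>\<^sub>x\<close>.
\<close>

definition kernel_comp :: "('a \<Rightarrow> 'b measure) \<Rightarrow> ('b \<Rightarrow> 'c measure) \<Rightarrow> 'a \<Rightarrow> 'c measure" where
  "kernel_comp K K' x = bind (K x) K'"

definition kernel_power :: "('a::topological_space \<Rightarrow> 'a measure) \<Rightarrow> nat \<Rightarrow> 'a \<Rightarrow> 'a measure" where
  "kernel_power K n = (kernel_comp K ^^ n) (return borel)"

text \<open>\<open>ula_kernel_prod gradU \<gamma> n l\<close> is \<open>R\<^bsub>\<gamma> n\<^esub> R\<^bsub>\<gamma> (n + 1)\<^esub> \<dots> R\<^bsub>\<gamma> l\<^esub>\<close>.\<close>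

definition ula_kernel_prod ::
    "('a::euclidean_space \<Rightarrow> 'a) \<Rightarrow> (nat \<Rightarrow> real) \<Rightarrow> nat \<Rightarrow> nat \<Rightarrow> 'a \<Rightarrow> 'a measure" where
  "ula_kernel_prod gradU \<gamma> n l =
     foldr kernel_comp (map (\<lambda>k. ula_kernel gradU (\<gamma> k)) [n..<Suc l]) (return borel)"

definition stationary_distribution ::
    "('a::topological_space \<Rightarrow> 'a measure) \<Rightarrow> 'a measure \<Rightarrow> bool" where
  "stationary_distribution K \<pi> \<longleftrightarrow> prob_space \<pi> \<and> sets \<pi> = sets borel \<and> bind \<pi> K = \<pi>"

definition ula_stationary :: "('a::euclidean_space \<Rightarrow> 'a) \<Rightarrow> real \<Rightarrow> 'a measure" where
  "ula_stationary gradU g = (THE \<pi>. stationary_distribution (ula_kernel gradU g) \<pi>)"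

definition tv_dist :: "'a::topological_space measure \<Rightarrow> 'a measure \<Rightarrow> real" where
  "tv_dist \<mu> \<nu> = (SUP A\<in>sets borel. \<bar>measure \<mu> A - measure \<nu> A\<bar>)"

definition couplings ::
    "'a::topological_space measure \<Rightarrow> 'a measure \<Rightarrow> ('a \<times> 'a) measure set" where
  "couplings \<mu> \<nu> = {\<zeta>. prob_space \<zeta> \<and> sets \<zeta> = sets (borel \<Otimes>\<^sub>M borel) \<and>
                        distr \<zeta> borel fst = \<mu> \<and> distr \<zeta> borel snd = \<nu>}"

definition W1 :: "'a::euclidean_space measure \<Rightarrow> 'a measure \<Rightarrow> ennreal" where
  "W1 \<mu> \<nu> = (INF \<zeta>\<in>couplings \<mu> \<nu>. \<integral>\<^sup>+ z. ennreal (dist (fst z) (snd z)) \<partial>\<zeta>)"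

definition std_normal_cdf :: "real \<Rightarrow> real" where
  "std_normal_cdf = cdf std_normal_distribution"

definition kappa :: "real \<Rightarrow> real \<Rightarrow> real" where
  "kappa m L = 2 * m * L / (m + L)"

text \<open>
  The case distinction is needed since \<open>inverse 0 = 0\<close> on the reals. For \<open>0 < \<kappa> \<gamma> j < 1\<close> the finite
  value is positive, so the coercion to \<^typ>\<open>ennreal\<close> truncates nothing; on \<^typ>\<open>ennreal\<close> division
  by \<open>\<infinity>\<close> yields \<open>0\<close>.
\<close>

definition Lam :: "real \<Rightarrow> (nat \<Rightarrow> real) \<Rightarrow> nat \<Rightarrow> nat \<Rightarrow> ennreal" where
  "Lam \<kappa> \<gamma> n l =
     (if \<exists>j\<in>{n..l}. \<kappa> * \<gamma> j = 1 then \<infinity>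
      else ennreal (inverse \<kappa> * ((\<Prod>j=n..l. inverse (1 - \<kappa> * \<gamma> j)) - 1)))"

definition ennsqrt :: "ennreal \<Rightarrow> ennreal" where
  "ennsqrt x = (if x = \<infinity> then \<infinity> else ennreal (sqrt (enn2real x)))"

end

theory Submission
  imports Defs
begin

text \<open>
  The total variation bounds come from reflecting one of two Gaussians onto the other. Let \<open>\<rho>\<close> be the
  reflection exchanging \<open>a\<close> and \<open>b\<close>, and let \<open>h\<close> satisfy \<open>\<bar>h x - h y\<bar> \<le> G \<bar>x - y\<bar>\<close> for an odd function \<open>G\<close>.
  Then \<open>h - h \<circ> \<rho>\<close> is odd under \<open>\<rho>\<close>, and the integrals of \<open>h\<close> against \<open>N(a, v I)\<close> and \<open>N(b, v I)\<close>
  differ by at most the mean of \<open>G (2 u)\<close> for \<open>u\<close> one-dimensional normal with mean \<open>\<bar>a - b\<bar> / 2\<close> and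
  variance \<open>v\<close>. For \<open>G r = 1 - 2 \<Phi> (- c r)\<close> this mean is again of the same form, with
  \<open>c / \<surd>(1 + 4 c\<^sup>2 v)\<close> in place of \<open>c\<close>, while the drift \<open>x \<mapsto> x - \<gamma> \<nabla>U x\<close> contracts distances by
  \<open>\<surd>(1 - \<kappa> \<gamma>)\<close>. Going through the steps backwards yields \<open>c\<^sup>2 = \<kappa> P / (8 (1 - P)) = 1 / (8 \<Lambda>)\<close>
  with \<open>P = \<Prod> (1 - \<kappa> \<gamma>\<^sub>j)\<close>. The resulting Lipschitz bound integrates over couplings, and it makes the
  laws of the chain started at the minimizer a Cauchy sequence in total variation, whose limit is the
  stationary distribution.
\<close>

section \<open>Normal laws on the real line\<close>

text \<open>\<open>1 - 2 * std_normal_cdf (- (c * r))\<close> is the total variation distance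
  between two isotropic Gaussians of variance 1/(4c^2) whose means are r apart. The family is closed
  under a step because variances add: smoothing with variance v replaces 1/(4c^2) by 1/(4c^2) + v,
  and the drift divides the result by 1 - \<kappa>\<gamma>. With v = 2\<gamma> and 1/(4c^2) =
  2\<Lambda> this reads \<Lambda>' = (\<Lambda> + \<gamma>) / (1 - \<kappa>\<gamma>), the recursion
  that the \<Lambda> of the theorem solves. Only the functions x \<mapsto> Q(x, A) are propagated,
  so no coupling of two chains has to be built; couplings enter only for the initial laws, through
  \<open>W1\<close>. An indicator has no modulus with finite c, so the last step is treated
  separately, with the odd modulus sgn. When m = L and \<gamma> = 2/(m + L), the factor 1 -
  \<kappa>\<gamma> vanishes and \<Lambda> is infinite; the induction therefore runs on P, which is
  translated into \<Lambda> only at the end.\<close>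

abbreviation normal_measure :: "real \<Rightarrow> real \<Rightarrow> real measure" where
  "normal_measure m s \<equiv> density lborel (\<lambda>x. ennreal (normal_density m s x))"

lemma normal_measure_affine:
  assumes "0 < s" "a \<noteq> 0"
  shows "distr (normal_measure m s) borel (\<lambda>x. b + a * x) = normal_measure (b + a * m) (\<bar>a\<bar> * s)"
proof -
  interpret prob_space "normal_measure m s" by (rule prob_space_normal_density) fact
  have "distributed (normal_measure m s) lborel (\<lambda>x. x) (normal_density m s)"
    by (simp add: distributed_def distr_id2)
  from normal_density_affine[OF this assms, of b] show ?thesis
    by (simp add: distributed_def cong: distr_cong)
qed

lemma measure_normal_atMost:
  assumes "0 < s"
  shows "measure (normal_measure m s) {..t} = std_normal_cdf ((t - m) / s)"
proof -
  have "normal_measure m s = distr std_normal_distribution borel (\<lambda>x. m + s * x)"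
    using normal_measure_affine[of 1 s 0 m] assms by simp
  then have "measure (normal_measure m s) {..t}
      = measure std_normal_distribution ((\<lambda>x. m + s * x) -` {..t} \<inter> space std_normal_distribution)"
    by (simp add: measure_distr)
  also have "(\<lambda>x. m + s * x) -` {..t} \<inter> space std_normal_distribution = {..(t - m) / s}"
    using assms by (auto simp: field_simps)
  finally show ?thesis by (simp add: std_normal_cdf_def cdf_def)
qed

lemma std_normal_cdf_uminus: "std_normal_cdf (- t) = 1 - std_normal_cdf t"
proof -
  interpret prob_space std_normal_distribution by (rule prob_space_normal_density) simp
  have sym: "distr std_normal_distribution borel (\<lambda>x. 0 + - 1 * x) = std_normal_distribution"
    by (subst normal_measure_affine) simp_all
  have "std_normal_cdf (- t) = measure (distr std_normal_distribution borel (\<lambda>x. 0 + - 1 * x)) {..- t}"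
    by (simp only: sym std_normal_cdf_def cdf_def)
  also have "\<dots> = measure std_normal_distribution {t..}"
    by (subst measure_distr) (auto intro!: arg_cong[where f="measure _"])
  also have "\<dots> = measure std_normal_distribution {t<..}"
  proof (rule finite_measure_eq_AE)
    have "AE x in lborel. x \<noteq> t" by (rule AE_lborel_singleton)
    then show "AE x in std_normal_distribution. x \<in> {t..} \<longleftrightarrow> x \<in> {t<..}"
      by (subst AE_density) (auto elim!: eventually_mono)
  qed auto
  also have "{t<..} = space std_normal_distribution - {..t}" by auto
  also have "measure std_normal_distribution \<dots> = 1 - std_normal_cdf t"
    by (subst prob_compl) (auto simp: std_normal_cdf_def cdf_def)
  finally show ?thesis .
qed

lemma std_normal_cdf_mono: "s \<le> t \<Longrightarrow> std_normal_cdf s \<le> std_normal_cdf t"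
proof -
  interpret real_distribution std_normal_distribution by (rule real_dist_normal_dist)
  show "s \<le> t \<Longrightarrow> std_normal_cdf s \<le> std_normal_cdf t"
    unfolding std_normal_cdf_def by (rule cdf_nondecreasing)
qed

lemma std_normal_cdf_measurable [measurable]: "std_normal_cdf \<in> borel_measurable borel"
  by (rule borel_measurable_mono) (simp add: mono_def std_normal_cdf_mono)

lemma std_normal_cdf_bounds: "0 \<le> std_normal_cdf t" "std_normal_cdf t \<le> 1"
proof -
  interpret real_distribution std_normal_distribution by (rule real_dist_normal_dist)
  show "0 \<le> std_normal_cdf t" "std_normal_cdf t \<le> 1"
    unfolding std_normal_cdf_def by (auto intro: cdf_nonneg cdf_bounded_prob)
qed

lemma std_normal_cdf_0: "std_normal_cdf 0 = 1 / 2"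
  using std_normal_cdf_uminus[of 0] by simp

text \<open>The normal density is at most 1 / sqrt (2 pi). This is the source of the circle constant
  in the Wasserstein and stationary bounds.\<close>

lemma std_normal_cdf_Lipschitz:
  assumes "0 \<le> t"
  shows "1 - 2 * std_normal_cdf (- t) \<le> 2 * t / sqrt (2 * pi)"
proof -
  interpret real_distribution std_normal_distribution by (rule real_dist_normal_dist)
  have "emeasure std_normal_distribution {-t<..0} \<le> ennreal (t / sqrt (2 * pi))"
  proof -
    have "emeasure std_normal_distribution {-t<..0}
        = (\<integral>\<^sup>+x. ennreal (std_normal_density x) * indicator {-t<..0} x \<partial>lborel)"
      by (simp add: emeasure_density)
    also have "\<dots> \<le> (\<integral>\<^sup>+x. ennreal (1 / sqrt (2 * pi)) * indicator {-t<..0} x \<partial>lborel)"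
      by (intro nn_integral_mono mult_right_mono ennreal_leI)
         (auto simp: std_normal_density_def divide_simps)
    also have "\<dots> = ennreal (t / sqrt (2 * pi))"
      using assms by (simp add: nn_integral_cmult_indicator ennreal_mult[symmetric])
    finally show ?thesis .
  qed
  then have "measure std_normal_distribution {-t<..0} \<le> t / sqrt (2 * pi)"
    using assms by (simp add: emeasure_eq_measure)
  moreover have "std_normal_cdf 0 - std_normal_cdf (- t) = measure std_normal_distribution {-t<..0}"
    using assms unfolding std_normal_cdf_def
    by (cases "t = 0") (auto simp: cdf_diff_eq)
  ultimately show ?thesis by (simp add: std_normal_cdf_0)
qed

text \<open>For X standard normal and independent of u, the integral is the probability of X + c u
  \<le> 0, and X + c u is normal with mean c m and variance 1 + c^2 s^2.\<close>

lemma integral_std_normal_cdf_normal: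
  assumes s: "0 < s" and c: "0 \<le> c"
  shows "(\<integral>u. std_normal_cdf (- (c * u)) \<partial>normal_measure m s)
       = std_normal_cdf (- (c * m) / sqrt (1 + c\<^sup>2 * s\<^sup>2))"
proof (cases "c = 0")
  case True
  interpret prob_space "normal_measure m s" by (rule prob_space_normal_density) fact
  show ?thesis using True prob_space by simp
next
  case False
  define \<tau> where "\<tau> = c * s"
  have \<tau>: "0 < \<tau>" using False s c by (simp add: \<tau>_def)
  interpret N: prob_space std_normal_distribution by (rule prob_space_normal_density) simp
  interpret T: prob_space "normal_measure 0 \<tau>" by (rule prob_space_normal_density) fact
  \<comment> \<open>Writing c u = c m + w with w centred of standard deviation c s makes the
    integral a convolution of two centred normal laws. Recovering u from w divides by c, hence the
    separate case c = 0.\<close>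
  have "normal_measure m s = distr (normal_measure 0 \<tau>) borel (\<lambda>x. m + (1/c) * x)"
    using False c \<tau> by (subst normal_measure_affine) (auto simp: \<tau>_def)
  then have "(\<integral>u. std_normal_cdf (- (c * u)) \<partial>normal_measure m s)
      = (\<integral>w. std_normal_cdf (- (c * (m + (1/c) * w))) \<partial>normal_measure 0 \<tau>)"
    by (simp add: integral_distr)
  also have "\<dots> = (\<integral>w. measure std_normal_distribution {a. a + w \<in> {..- (c * m)}} \<partial>normal_measure 0 \<tau>)"
    using False by (intro Bochner_Integration.integral_cong)
      (auto simp: std_normal_cdf_def cdf_def distrib_left intro!: arg_cong[where f="measure _"])
  also have "\<dots> = measure (convolution (normal_measure 0 \<tau>) std_normal_distribution) {..- (c * m)}"
  proof -
    have "emeasure (convolution (normal_measure 0 \<tau>) std_normal_distribution) {..- (c * m)}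
       = (\<integral>\<^sup>+w. emeasure std_normal_distribution {a. a + w \<in> {..- (c * m)}} \<partial>normal_measure 0 \<tau>)"
      by (rule convolution_emeasure) (auto intro: N.finite_measure_axioms T.finite_measure_axioms)
    then show ?thesis
      by (simp add: N.emeasure_eq_measure measure_def[of "convolution _ _"] integral_eq_nn_integral)
  qed
  also have "convolution (normal_measure 0 \<tau>) std_normal_distribution = normal_measure 0 (sqrt (1 + \<tau>\<^sup>2))"
    using conv_normal_density_zero_mean[of \<tau> 1] \<tau>
    by (subst convolution_density)
       (auto intro: N.finite_measure_axioms T.finite_measure_axioms simp: fun_eq_iff ennreal_mult add.commute)
  also have "measure \<dots> {..- (c * m)} = std_normal_cdf (- (c * m) / sqrt (1 + c\<^sup>2 * s\<^sup>2))"
    by (subst measure_normal_atMost) (auto simp: \<tau>_def power_mult_distrib add_pos_nonneg)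
  finally show ?thesis .
qed

section \<open>Reflections and Lebesgue measure\<close>

text \<open>Weil's Fubini argument for the uniqueness of Haar measure, normalised on a ball.\<close>

lemma lborel_distr_orthogonal_transformation:
  fixes f :: "'a::euclidean_space \<Rightarrow> 'a"
  assumes f: "orthogonal_transformation f"
  shows "distr lborel borel f = lborel"
proof -
  have lin: "linear f" and nrm: "\<And>x. norm (f x) = norm x"
    using f by (auto simp: orthogonal_transformation_linear orthogonal_transformation_norm)
  have [measurable]: "f \<in> borel_measurable borel"
    using lin by (intro borel_measurable_continuous_onI linear_continuous_on) (simp add: linear_conv_bounded_linear)
  obtain g where g: "orthogonal_transformation g" "\<And>x. f (g x) = x" "\<And>x. g (f x) = x"
    using f orthogonal_transformation_inv orthogonal_transformation_bij
    by (metis bij_inv_eq_iff)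
  define B :: "'a set" where "B = ball 0 1"
  have [measurable]: "B \<in> sets borel" by (simp add: B_def)
  let ?M = "distr lborel borel f"
  have vim: "f -` B = B" by (auto simp: nrm B_def)
  have ball_fin: "emeasure lborel B \<noteq> \<infinity>"
    unfolding B_def by (metis emeasure_lborel_ball_finite infinity_ennreal_def less_irrefl)
  have ball_pos: "emeasure lborel B \<noteq> 0"
    using content_ball_pos[of 1 "0::'a"] by (auto simp: B_def measure_def)
  have shift: "(\<integral>\<^sup>+x. h (x + y) \<partial>lborel) = (\<integral>\<^sup>+x. h x \<partial>lborel)"
    if [measurable]: "h \<in> borel_measurable borel" for h :: "'a \<Rightarrow> ennreal" and y
    by (subst (2) lborel_distr_plus[of y, symmetric]) (simp add: nn_integral_distr add.commute)
  have uminus: "distr lborel borel (\<lambda>x. - x) = (lborel :: 'a measure)"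
    using lborel_affine[of "-1" "0::'a"] by (simp add: density_1)
  have neg: "(\<integral>\<^sup>+x. h (- x) \<partial>lborel) = (\<integral>\<^sup>+x. h x \<partial>lborel)"
    if [measurable]: "h \<in> borel_measurable borel" for h :: "'a \<Rightarrow> ennreal"
    by (subst (2) uminus[symmetric]) (simp add: nn_integral_distr)
  have emeasure_M: "emeasure ?M C = (\<integral>\<^sup>+x. indicator C (f x) \<partial>lborel)" if [measurable]: "C \<in> sets borel" for C
    by (subst nn_integral_indicator[symmetric]) (simp_all add: nn_integral_distr del: nn_integral_indicator)
  show ?thesis
  proof (rule measure_eqI)
    fix A :: "'a set" assume "A \<in> sets ?M"
    then have [measurable]: "A \<in> sets borel" by simp
    \<comment> \<open>Invariance of \<open>lborel\<close> is available for translations and for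
      negation. The chain uses these, with \<open>g y\<close> as the preimage of y, to move the
      image measure from \<open>A\<close> to \<open>B\<close>; the ball \<open>B\<close> is its own
      preimage and has positive finite mass, so it cancels.\<close>
    have "emeasure ?M A * emeasure lborel B
        = (\<integral>\<^sup>+x. \<integral>\<^sup>+y. indicator A (f x) * indicator B y \<partial>lborel \<partial>lborel)"
      by (simp add: nn_integral_cmult_indicator nn_integral_multc emeasure_M)
    also have "\<dots> = (\<integral>\<^sup>+x. \<integral>\<^sup>+y. indicator A (f x) * indicator B (y + f x) \<partial>lborel \<partial>lborel)"
      by (rule nn_integral_cong, rule shift[of "\<lambda>y. indicator A (f x) * indicator B y" "f x" for x, symmetric]) measurable
    also have "\<dots> = (\<integral>\<^sup>+y. \<integral>\<^sup>+x. indicator A (f x) * indicator B (y + f x) \<partial>lborel \<partial>lborel)"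
      by (rule lborel_pair.Fubini') measurable
    also have "\<dots> = (\<integral>\<^sup>+y. \<integral>\<^sup>+x. indicator A (f x - y) * indicator B (f x) \<partial>lborel \<partial>lborel)"
    proof (rule nn_integral_cong)
      fix y
      have "f (x - g y) = f x - y" for x using lin g(2) by (simp add: linear_diff)
      then show "(\<integral>\<^sup>+x. indicator A (f x) * indicator B (y + f x) \<partial>lborel)
          = (\<integral>\<^sup>+x. indicator A (f x - y) * indicator B (f x) \<partial>lborel)"
        by (subst shift[of "\<lambda>x. indicator A (f x) * indicator B (y + f x)" "- g y", symmetric]) simp_all
    qed
    also have "\<dots> = (\<integral>\<^sup>+x. \<integral>\<^sup>+y. indicator B (f x) * indicator A (f x - y) \<partial>lborel \<partial>lborel)"
      by (subst lborel_pair.Fubini') (auto simp: mult.commute)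
    also have "\<dots> = (\<integral>\<^sup>+x. indicator B (f x) * emeasure lborel A \<partial>lborel)"
    proof (rule nn_integral_cong)
      fix x
      have "(\<integral>\<^sup>+y. indicator A (f x - y) \<partial>lborel) = (\<integral>\<^sup>+y. indicator A (f x + y) \<partial>lborel)"
        by (subst neg[of "\<lambda>y. indicator A (f x + y)", symmetric]) simp_all
      also have "\<dots> = emeasure lborel A"
        using shift[of "indicator A" "f x"] by (simp add: add.commute)
      finally show "(\<integral>\<^sup>+y. indicator B (f x) * indicator A (f x - y) \<partial>lborel)
          = indicator B (f x) * emeasure lborel A"
        by (simp add: nn_integral_cmult)
    qed
    also have "\<dots> = emeasure lborel A * emeasure ?M B"
      by (subst nn_integral_multc, measurable) (simp add: mult.commute emeasure_M)
    also have "emeasure ?M B = emeasure lborel B"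
      by (simp add: emeasure_distr vim)
    finally have "emeasure ?M A * emeasure lborel B / emeasure lborel B
        = emeasure lborel A * emeasure lborel B / emeasure lborel B"
      by (rule arg_cong)
    then show "emeasure ?M A = emeasure lborel A"
      using ball_fin ball_pos by (simp only: mult_divide_eq_ennreal infinity_ennreal_def not_False_eq_True)
  qed simp
qed

text \<open>The reflection exchanging \<open>a\<close> and \<open>b\<close>; for \<open>a = b\<close> it is the identity because \<open>x / 0 = 0\<close>.\<close>

definition bisector_reflection :: "'a::euclidean_space \<Rightarrow> 'a \<Rightarrow> 'a \<Rightarrow> 'a" where
  "bisector_reflection a b z = z - (2 * ((z - (1/2) *\<^sub>R (a + b)) \<bullet> (a - b)) / ((a - b) \<bullet> (a - b))) *\<^sub>R (a - b)"

lemma orthogonal_transformation_reflection: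
  "orthogonal_transformation (\<lambda>z::'a::euclidean_space. z - (2 * (z \<bullet> v) / (v \<bullet> v)) *\<^sub>R v)"
  unfolding orthogonal_transformation_def
proof (intro conjI allI)
  show "linear (\<lambda>z. z - (2 * (z \<bullet> v) / (v \<bullet> v)) *\<^sub>R v)"
    by (rule linearI) (auto simp: inner_add_left algebra_simps add_divide_distrib)
  show "(x - (2 * (x \<bullet> v) / (v \<bullet> v)) *\<^sub>R v) \<bullet> (y - (2 * (y \<bullet> v) / (v \<bullet> v)) *\<^sub>R v) = x \<bullet> y" for x y
    by (cases "v = 0") (auto simp: inner_diff_left inner_diff_right inner_commute field_simps)
qed

text \<open>Splits the affine reflection into a translation and a linear orthogonal map, so that
  isometry and invariance of Lebesgue measure follow from the linear case.\<close>

lemma bisector_reflection_eq: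
  fixes a b :: "'a::euclidean_space"
  defines "S \<equiv> \<lambda>z. z - (2 * (z \<bullet> (a - b)) / ((a - b) \<bullet> (a - b))) *\<^sub>R (a - b)"
  shows "bisector_reflection a b z = (1/2) *\<^sub>R (a + b) - S ((1/2) *\<^sub>R (a + b)) + S z"
proof -
  have "(z - m) \<bullet> w = z \<bullet> w - m \<bullet> w" for m w :: 'a by (rule inner_diff_left)
  then show ?thesis
    unfolding S_def bisector_reflection_def
    by (simp only: scaleR_diff_left[symmetric] diff_divide_distrib right_diff_distrib)
       (simp add: algebra_simps)
qed

lemma bisector_reflection_swap:
  fixes a b :: "'a::euclidean_space"
  shows "bisector_reflection a b a = b" "bisector_reflection a b b = a"
proof -
  define w where "w = a - b"
  have *: "2 * ((a - (1/2) *\<^sub>R (a + b)) \<bullet> w) = w \<bullet> w" "2 * ((b - (1/2) *\<^sub>R (a + b)) \<bullet> w) = - (w \<bullet> w)"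
    by (simp_all add: w_def inner_diff_left inner_diff_right inner_add_left inner_add_right inner_commute field_simps)
  have "(w \<bullet> w / (w \<bullet> w)) *\<^sub>R w = w" "(- (w \<bullet> w) / (w \<bullet> w)) *\<^sub>R w = - w"
    by (cases "w = 0"; simp)+
  then show "bisector_reflection a b a = b" "bisector_reflection a b b = a"
    by (simp_all only: bisector_reflection_def w_def[symmetric] *) (simp_all add: w_def)
qed

lemma bisector_reflection_dist:
  fixes a b :: "'a::euclidean_space"
  shows "dist (bisector_reflection a b x) (bisector_reflection a b y) = dist x y"
proof -
  have "norm (S x - S y) = norm (x - y)" if "orthogonal_transformation S" for S :: "'a \<Rightarrow> 'a"
    using linear_diff[OF orthogonal_transformation_linear[OF that], of x y]
      orthogonal_transformation_norm[OF that, of "x - y"] by simp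
  from this[OF orthogonal_transformation_reflection] show ?thesis
    by (simp add: bisector_reflection_eq dist_norm)
qed

lemma bisector_reflection_involution: "bisector_reflection a b (bisector_reflection a b z) = z"
proof -
  define w where "w = a - b"
  define k where "k = 2 * ((z - (1/2) *\<^sub>R (a + b)) \<bullet> w) / (w \<bullet> w)"
  have 1: "bisector_reflection a b z = z - k *\<^sub>R w" by (simp add: bisector_reflection_def k_def w_def)
  have "2 * ((z - k *\<^sub>R w - (1/2) *\<^sub>R (a + b)) \<bullet> w) / (w \<bullet> w) = - k" if "w \<noteq> 0"
  proof -
    have "2 * ((z - k *\<^sub>R w - (1/2) *\<^sub>R (a + b)) \<bullet> w)
        = 2 * ((z - (1/2) *\<^sub>R (a + b)) \<bullet> w) - 2 * k * (w \<bullet> w)"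
      by (simp add: inner_diff_left algebra_simps)
    then show ?thesis using that by (simp add: k_def diff_divide_distrib)
  qed
  then show ?thesis
    unfolding 1 by (cases "w = 0") (simp_all add: bisector_reflection_def w_def[symmetric])
qed

lemma bisector_reflection_measurable [measurable]: "bisector_reflection a b \<in> borel_measurable borel"
  unfolding bisector_reflection_def by measurable

lemma lborel_distr_bisector_reflection: "distr lborel borel (bisector_reflection a b) = lborel"
proof -
  define S where "S = (\<lambda>z. z - (2 * (z \<bullet> (a - b)) / ((a - b) \<bullet> (a - b))) *\<^sub>R (a - b))"
  have [measurable]: "S \<in> borel_measurable borel" unfolding S_def by measurable
  have S: "distr lborel borel S = lborel"
    unfolding S_def by (intro lborel_distr_orthogonal_transformation orthogonal_transformation_reflection)
  define t where "t = (1/2) *\<^sub>R (a + b) - S ((1/2) *\<^sub>R (a + b))"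
  have "bisector_reflection a b = (+) t \<circ> S"
    by (rule ext) (simp add: t_def S_def bisector_reflection_eq[of a b])
  then have "distr lborel borel (bisector_reflection a b) = distr (distr lborel borel S) borel ((+) t)"
    by (subst distr_distr) simp_all
  then show ?thesis by (simp add: S lborel_distr_plus)
qed

section \<open>Isotropic Gaussian laws\<close>

lemma iso_gaussian_sets [simp, measurable_cong]: "sets (iso_gaussian \<mu> v) = sets borel"
  and iso_gaussian_space [simp]: "space (iso_gaussian \<mu> v) = UNIV"
  by (simp_all add: iso_gaussian_def)

lemma emeasure_normal_UNIV:
  assumes "0 < s"
  shows "emeasure (normal_measure m s) UNIV = 1"
proof -
  interpret prob_space "normal_measure m s" by (rule prob_space_normal_density) fact
  show ?thesis using emeasure_space_1 by (simp only: space_density space_lborel space_borel)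
qed

lemma iso_gaussian_density_prod:
  fixes y \<mu> :: "'a::euclidean_space"
  assumes "0 < v"
  shows "(2 * pi * v) powr (- real DIM('a) / 2) * exp (- (norm (y - \<mu>))\<^sup>2 / (2 * v))
       = (\<Prod>b\<in>Basis. normal_density (\<mu> \<bullet> b) (sqrt v) (y \<bullet> b))"
proof -
  have "(\<Prod>b\<in>(Basis::'a set). normal_density (\<mu> \<bullet> b) (sqrt v) (y \<bullet> b))
      = (1 / sqrt (2 * pi * v)) ^ DIM('a) * exp (\<Sum>b\<in>(Basis::'a set). - (y \<bullet> b - \<mu> \<bullet> b)\<^sup>2 / (2 * v))"
    using assms by (simp add: normal_density_def prod.distrib exp_sum[symmetric] prod_dividef power_divide)
  also have "(1 / sqrt (2 * pi * v)) ^ DIM('a) = ((2 * pi * v) powr (- 1 / 2)) ^ DIM('a)"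
    using assms by (simp add: powr_half_sqrt[symmetric] powr_minus_divide[symmetric])
  also have "\<dots> = (2 * pi * v) powr (- real DIM('a) / 2)"
    using assms by (subst powr_power) (auto simp: field_simps)
  also have "(\<Sum>b\<in>(Basis::'a set). - (y \<bullet> b - \<mu> \<bullet> b)\<^sup>2 / (2 * v)) = - (norm (y - \<mu>))\<^sup>2 / (2 * v)"
    unfolding power2_norm_eq_inner
    by (subst euclidean_inner) (simp add: sum_negf sum_divide_distrib inner_diff_left power2_eq_square)
  finally show ?thesis ..
qed

text \<open>The density factorises over \<open>Basis\<close>, so Fubini applies to product
  integrands. Constant factors then give the total mass, and a single indicator factor gives a
  coordinate marginal.\<close>

lemma nn_integral_iso_gaussian_prod:
  fixes \<mu> :: "'a::euclidean_space" and f :: "'a \<Rightarrow> real \<Rightarrow> ennreal"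
  assumes v: "0 < v" and [measurable]: "\<And>b. b \<in> Basis \<Longrightarrow> f b \<in> borel_measurable borel"
  shows "(\<integral>\<^sup>+z. (\<Prod>b\<in>Basis. f b (z \<bullet> b)) \<partial>iso_gaussian \<mu> v)
       = (\<Prod>b\<in>Basis. \<integral>\<^sup>+u. f b u \<partial>normal_measure (\<mu> \<bullet> b) (sqrt v))"
proof -
  have "(\<integral>\<^sup>+z. (\<Prod>b\<in>Basis. f b (z \<bullet> b)) \<partial>iso_gaussian \<mu> v)
      = (\<integral>\<^sup>+z. (\<Prod>b\<in>Basis. ennreal (normal_density (\<mu> \<bullet> b) (sqrt v) (z \<bullet> b)) * f b (z \<bullet> b)) \<partial>lborel)"
    unfolding iso_gaussian_def iso_gaussian_density_prod[OF v]
    by (subst nn_integral_density) (auto simp: prod.distrib prod_ennreal[symmetric])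
  also have "\<dots> = (\<Prod>b\<in>Basis. \<integral>\<^sup>+u. ennreal (normal_density (\<mu> \<bullet> b) (sqrt v) u) * f b u \<partial>lborel)"
    by (subst nn_integral_lborel_prod[symmetric]) auto
  also have "\<dots> = (\<Prod>b\<in>Basis. \<integral>\<^sup>+u. f b u \<partial>normal_measure (\<mu> \<bullet> b) (sqrt v))"
    by (intro prod.cong) (auto simp: nn_integral_density)
  finally show ?thesis .
qed

lemma prob_space_iso_gaussian:
  fixes \<mu> :: "'a::euclidean_space"
  assumes "0 < v"
  shows "prob_space (iso_gaussian \<mu> v)"
proof
  have "emeasure (normal_measure m (sqrt v)) UNIV = 1" for m
    by (rule emeasure_normal_UNIV) (simp add: assms)
  then show "emeasure (iso_gaussian \<mu> v) (space (iso_gaussian \<mu> v)) = 1"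
    using nn_integral_iso_gaussian_prod[OF assms, of "\<lambda>_ _. 1" \<mu>] by simp
qed

lemma distr_iso_gaussian_Basis:
  fixes \<mu> b :: "'a::euclidean_space"
  assumes v: "0 < v" and b: "b \<in> Basis"
  shows "distr (iso_gaussian \<mu> v) borel (\<lambda>z. z \<bullet> b) = normal_measure (\<mu> \<bullet> b) (sqrt v)"
proof (rule measure_eqI)
  fix A assume "A \<in> sets (distr (iso_gaussian \<mu> v) borel (\<lambda>z. z \<bullet> b))"
  then have [measurable]: "A \<in> sets borel" by simp
  define f :: "'a \<Rightarrow> real \<Rightarrow> ennreal" where "f i u = (if i = b then indicator A u else 1)" for i u
  have [measurable]: "f i \<in> borel_measurable borel" for i
    unfolding f_def by (cases "i = b") simp_all
  have one: "emeasure (normal_measure m (sqrt v)) UNIV = 1" for m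
    by (rule emeasure_normal_UNIV) (simp add: v)
  have "emeasure (distr (iso_gaussian \<mu> v) borel (\<lambda>z. z \<bullet> b)) A
      = (\<integral>\<^sup>+z. indicator A (z \<bullet> b) \<partial>iso_gaussian \<mu> v)"
    by (subst nn_integral_indicator[symmetric]) (simp_all add: nn_integral_distr del: nn_integral_indicator)
  also have "\<dots> = (\<integral>\<^sup>+z. (\<Prod>i\<in>Basis. f i (z \<bullet> i)) \<partial>iso_gaussian \<mu> v)"
    using b by (simp add: f_def prod.delta)
  also have "\<dots> = (\<Prod>i\<in>Basis. \<integral>\<^sup>+u. f i u \<partial>normal_measure (\<mu> \<bullet> i) (sqrt v))"
    by (rule nn_integral_iso_gaussian_prod[OF v]) simp
  also have "\<dots> = (\<Prod>i\<in>Basis. if i = b then emeasure (normal_measure (\<mu> \<bullet> b) (sqrt v)) A else 1)"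
    by (intro prod.cong refl) (simp add: f_def one)
  also have "\<dots> = emeasure (normal_measure (\<mu> \<bullet> b) (sqrt v)) A"
    using b by (simp add: prod.delta)
  finally show "emeasure (distr (iso_gaussian \<mu> v) borel (\<lambda>z. z \<bullet> b)) A
      = emeasure (normal_measure (\<mu> \<bullet> b) (sqrt v)) A" .
qed simp

text \<open>The density depends on y only through its distance to the mean, so a measure-preserving
  isometry merely moves the centre.\<close>

lemma distr_iso_gaussian_isometry:
  fixes T :: "'a::euclidean_space \<Rightarrow> 'a"
  assumes [measurable]: "T \<in> borel_measurable borel"
    and leb: "distr lborel borel T = lborel"
    and iso: "\<And>x y. dist (T x) (T y) = dist x y"
  shows "distr (iso_gaussian \<mu> v) borel T = iso_gaussian (T \<mu>) v"
proof -
  define p where "p y = ennreal ((2 * pi * v) powr (- real DIM('a) / 2) * exp (- (norm (y - T \<mu>))\<^sup>2 / (2 * v)))" for y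
  have [measurable]: "p \<in> borel_measurable borel" unfolding p_def by measurable
  have "iso_gaussian \<mu> v = density lborel (p \<circ> T)"
    using iso by (simp add: iso_gaussian_def p_def comp_def dist_norm)
  then have "distr (iso_gaussian \<mu> v) borel T = density (distr lborel borel T) p"
    by (simp add: density_distr comp_def)
  then show ?thesis by (simp only: leb iso_gaussian_def p_def[symmetric])
qed

text \<open>Rotational invariance without a change of basis: the reflection exchanging
  \<open>e\<close> with some basis vector turns the marginal along \<open>e\<close> into a
  coordinate marginal.\<close>

lemma distr_iso_gaussian_inner:
  fixes \<mu> e :: "'a::euclidean_space"
  assumes v: "0 < v" and e: "norm e = 1"
  shows "distr (iso_gaussian \<mu> v) borel (\<lambda>z. z \<bullet> e) = normal_measure (\<mu> \<bullet> e) (sqrt v)"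
proof -
  obtain b :: 'a where b: "b \<in> Basis" using nonempty_Basis by blast
  define T where "T = bisector_reflection e b"
  \<comment> \<open>Both vectors have norm 1, so the bisecting hyperplane passes through the origin
    and \<open>T\<close> is linear.\<close>
  have "(e + b) \<bullet> (e - b) = 0"
    using e b by (simp add: inner_diff_right inner_add_left inner_commute[of b e] norm_eq_1)
  then have "T = (\<lambda>z. z - (2 * (z \<bullet> (e - b)) / ((e - b) \<bullet> (e - b))) *\<^sub>R (e - b))"
    by (simp add: T_def bisector_reflection_def inner_diff_left fun_eq_iff)
  then have orth: "orthogonal_transformation T"
    using orthogonal_transformation_reflection[of "e - b"] by simp
  have inn: "T z \<bullet> b = z \<bullet> e" for z
    using orth bisector_reflection_swap(1)[of e b] unfolding T_def orthogonal_transformation_def by metis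
  have [measurable]: "T \<in> borel_measurable borel" by (simp add: T_def)
  have "distr (iso_gaussian \<mu> v) borel (\<lambda>z. z \<bullet> e) = distr (distr (iso_gaussian \<mu> v) borel T) borel (\<lambda>z. z \<bullet> b)"
    by (subst distr_distr) (simp_all add: comp_def inn)
  also have "distr (iso_gaussian \<mu> v) borel T = iso_gaussian (T \<mu>) v"
    by (rule distr_iso_gaussian_isometry)
       (simp_all add: T_def bisector_reflection_dist lborel_distr_bisector_reflection)
  finally show ?thesis by (simp add: distr_iso_gaussian_Basis v b inn)
qed

section \<open>Second moments of Gaussian laws\<close>

lemma nn_integral_normal_second_moment:
  assumes "0 < s"
  shows "(\<integral>\<^sup>+u. ennreal ((u - q)\<^sup>2) \<partial>normal_measure m s) = ennreal (s\<^sup>2 + (m - q)\<^sup>2)"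
proof -
  \<comment> \<open>(u - q)^2 is expanded around the mean m; the linear term has vanishing
    integral.\<close>
  have "has_bochner_integral lborel
     (\<lambda>u. normal_density m s u * (u - m) ^ (2 * 1) + 2 * (m - q) * (normal_density m s u * (u - m) ^ (2 * 0 + 1))
        + (m - q)\<^sup>2 * normal_density m s u)
     (fact (2 * 1) / ((2 / s\<^sup>2) ^ 1 * fact 1) + 2 * (m - q) * 0 + (m - q)\<^sup>2 * 1)"
    using assms
    by (intro has_bochner_integral_add has_bochner_integral_mult_right normal_moment_even normal_moment_odd)
       (auto simp: has_bochner_integral_iff)
  moreover have "(\<lambda>u. normal_density m s u * (u - m) ^ (2 * 1) + 2 * (m - q) * (normal_density m s u * (u - m) ^ (2 * 0 + 1))
        + (m - q)\<^sup>2 * normal_density m s u) = (\<lambda>u. normal_density m s u * (u - q)\<^sup>2)"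
    by (auto simp: fun_eq_iff power2_eq_square algebra_simps)
  ultimately have "has_bochner_integral lborel (\<lambda>u. normal_density m s u * (u - q)\<^sup>2) (s\<^sup>2 + (m - q)\<^sup>2)"
    by simp
  then show ?thesis
    by (simp add: nn_integral_density ennreal_mult[symmetric] nn_integral_eq_integral has_bochner_integral_iff)
qed

lemma nn_integral_iso_gaussian_second_moment:
  fixes \<mu> p :: "'a::euclidean_space"
  assumes v: "0 < v"
  shows "(\<integral>\<^sup>+z. ennreal ((dist z p)\<^sup>2) \<partial>iso_gaussian \<mu> v) = ennreal ((dist \<mu> p)\<^sup>2 + real DIM('a) * v)"
proof -
  have sq: "(dist z p)\<^sup>2 = (\<Sum>b\<in>Basis. (z \<bullet> b - p \<bullet> b)\<^sup>2)" for z
    unfolding dist_norm power2_norm_eq_inner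
    by (subst euclidean_inner) (simp add: inner_diff_left power2_eq_square)
  have "(\<integral>\<^sup>+z. ennreal ((dist z p)\<^sup>2) \<partial>iso_gaussian \<mu> v)
      = (\<Sum>b\<in>Basis. \<integral>\<^sup>+z. ennreal ((z \<bullet> b - p \<bullet> b)\<^sup>2) \<partial>iso_gaussian \<mu> v)"
    unfolding sq by (subst nn_integral_sum[symmetric]) (auto simp: sum_ennreal)
  also have "\<dots> = (\<Sum>b\<in>(Basis::'a set). ennreal (v + (\<mu> \<bullet> b - p \<bullet> b)\<^sup>2))"
  proof (rule sum.cong)
    fix b :: 'a assume b: "b \<in> Basis"
    have "(\<integral>\<^sup>+z. ennreal ((z \<bullet> b - p \<bullet> b)\<^sup>2) \<partial>iso_gaussian \<mu> v)
        = (\<integral>\<^sup>+u. ennreal ((u - p \<bullet> b)\<^sup>2) \<partial>distr (iso_gaussian \<mu> v) borel (\<lambda>z. z \<bullet> b))"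
      by (simp add: nn_integral_distr)
    then show "(\<integral>\<^sup>+z. ennreal ((z \<bullet> b - p \<bullet> b)\<^sup>2) \<partial>iso_gaussian \<mu> v) = ennreal (v + (\<mu> \<bullet> b - p \<bullet> b)\<^sup>2)"
      using v by (simp add: distr_iso_gaussian_Basis b nn_integral_normal_second_moment)
  qed simp
  also have "\<dots> = ennreal ((dist \<mu> p)\<^sup>2 + real DIM('a) * v)"
    using v by (subst sum_ennreal) (auto simp: sum.distrib sq add.commute)
  finally show ?thesis .
qed

section \<open>Comparison of two Gaussians by reflection\<close>

lemma bisector_reflection_dist_self:
  fixes a b z :: "'a::euclidean_space"
  assumes "a \<noteq> b"
  shows "dist z (bisector_reflection a b z)
       = 2 * \<bar>(z - (1/2) *\<^sub>R (a + b)) \<bullet> ((1 / dist a b) *\<^sub>R (a - b))\<bar>"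
proof -
  have "dist z (bisector_reflection a b z)
      = \<bar>2 * ((z - (1/2) *\<^sub>R (a + b)) \<bullet> (a - b)) / ((a - b) \<bullet> (a - b))\<bar> * norm (a - b)"
    by (simp add: bisector_reflection_def dist_norm)
  also have "(a - b) \<bullet> (a - b) = norm (a - b) * norm (a - b)"
    by (simp add: power2_norm_eq_inner[symmetric] power2_eq_square)
  also have "\<bar>2 * ((z - (1/2) *\<^sub>R (a + b)) \<bullet> (a - b)) / (norm (a - b) * norm (a - b))\<bar> * norm (a - b)
      = 2 * \<bar>(z - (1/2) *\<^sub>R (a + b)) \<bullet> (a - b)\<bar> / norm (a - b)"
    using assms by (simp add: abs_mult)
  finally show ?thesis by (simp add: dist_norm abs_mult)
qed

text \<open>Pairing z with its mirror image replaces h by k = h - h \<circ> \<rho>. The distance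
  from z to its image is 2 |t z|, with t the signed coordinate normal to the bisecting hyperplane,
  so |k| \<le> g (2 |t|). Integrating that directly would give the mean of g (2 |t|), which is too
  large. Since k is odd under \<rho>, its mean under N(a, v I) is half its integral against the
  difference of the two densities, and this difference has the sign of t. Hence g (2 |t|) may be
  replaced by the odd function g (2 t), and the difference of densities is folded back in the same
  way.\<close>

lemma iso_gaussian_smoothing_aux:
  fixes a b :: "'a::euclidean_space" and h :: "'a \<Rightarrow> real" and g :: "real \<Rightarrow> real"
  assumes v: "0 < v" and ab: "a \<noteq> b"
    and [measurable]: "h \<in> borel_measurable borel" "g \<in> borel_measurable borel"
    and h: "\<And>x. 0 \<le> h x" "\<And>x. h x \<le> 1"
    and g_odd: "\<And>r. g (- r) = - g r" and g_bdd: "\<And>r. \<bar>g r\<bar> \<le> 1"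
    and hg: "\<And>x y. \<bar>h x - h y\<bar> \<le> g (dist x y)"
  shows "(\<integral>z. h z \<partial>iso_gaussian a v) - (\<integral>z. h z \<partial>iso_gaussian b v)
       \<le> (\<integral>u. g (2 * u) \<partial>normal_measure (dist a b / 2) (sqrt v))"
proof -
  interpret Pa: prob_space "iso_gaussian a v" by (rule prob_space_iso_gaussian[OF v])
  interpret Pb: prob_space "iso_gaussian b v" by (rule prob_space_iso_gaussian[OF v])
  define \<rho> where "\<rho> = bisector_reflection a b"
  define m where "m = (1/2) *\<^sub>R (a + b)"
  define e where "e = (1 / dist a b) *\<^sub>R (a - b)"
  define t where "t z = (z - m) \<bullet> e" for z
  define k where "k z = h z - h (\<rho> z)" for z
  define p where "p c z = (2 * pi * v) powr (- real DIM('a) / 2) * exp (- (norm (z - c))\<^sup>2 / (2 * v))" for c z :: 'a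
  have [measurable]: "\<rho> \<in> borel_measurable borel" by (simp add: \<rho>_def)
  have [measurable]: "t \<in> borel_measurable borel" unfolding t_def by measurable
  have [measurable]: "k \<in> borel_measurable borel" unfolding k_def by measurable
  have [measurable]: "p c \<in> borel_measurable borel" for c unfolding p_def by measurable
  have r: "0 < dist a b" using ab by simp
  have e1: "norm e = 1" using r by (simp add: e_def dist_norm)
  have kg: "\<bar>k z\<bar> \<le> g (2 * \<bar>t z\<bar>)" for z
    using hg[of z "\<rho> z"] bisector_reflection_dist_self[OF ab, of z] by (simp add: k_def \<rho>_def t_def m_def e_def)
  have kb: "\<bar>k z\<bar> \<le> 1" for z using h[of z] h[of "\<rho> z"] by (simp add: k_def)
  have swap: "distr (iso_gaussian a v) borel \<rho> = iso_gaussian b v" "distr (iso_gaussian b v) borel \<rho> = iso_gaussian a v"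
    using distr_iso_gaussian_isometry[of \<rho>]
    by (simp_all add: \<rho>_def lborel_distr_bisector_reflection bisector_reflection_dist bisector_reflection_swap)
  have swap_int: "(\<integral>z. f z \<partial>iso_gaussian b v) = (\<integral>z. f (\<rho> z) \<partial>iso_gaussian a v)"
    if [measurable]: "f \<in> borel_measurable borel" for f :: "'a \<Rightarrow> real"
    by (subst swap(1)[symmetric]) (simp add: integral_distr)
  have k\<rho>: "k (\<rho> z) = - k z" for z by (simp add: k_def \<rho>_def bisector_reflection_involution)
  have t\<rho>: "t (\<rho> z) = - t z" for z
  proof -
    have "2 * ((z - m) \<bullet> (a - b)) / ((a - b) \<bullet> (a - b)) * ((a - b) \<bullet> e) = 2 * t z"
      using r by (simp add: t_def e_def dist_norm power2_norm_eq_inner[symmetric] power2_eq_square)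
    then show ?thesis
      by (simp add: t_def \<rho>_def bisector_reflection_def m_def[symmetric] inner_diff_left)
  qed
  have p_le: "(p b z \<le> p a z) = (0 \<le> t z)" for z
  proof -
    have "(norm (z - b))\<^sup>2 - (norm (z - a))\<^sup>2 = 2 * ((z - m) \<bullet> (a - b))"
      unfolding power2_norm_eq_inner
      by (simp add: m_def inner_diff_left inner_diff_right inner_add_left inner_add_right inner_commute field_simps)
    then have "(norm (z - b))\<^sup>2 - (norm (z - a))\<^sup>2 = 2 * (t z * dist a b)"
      using r by (simp add: t_def e_def)
    moreover have "(p b z \<le> p a z) = ((norm (z - a))\<^sup>2 \<le> (norm (z - b))\<^sup>2)"
      using v by (simp add: p_def divide_le_cancel)
    ultimately show ?thesis using r by (smt (verit) mult_nonneg_nonneg mult_neg_pos)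
  qed
  have dens: "(\<integral>z. f z \<partial>iso_gaussian c v) = (\<integral>z. p c z * f z \<partial>lborel)"
    if [measurable]: "f \<in> borel_measurable borel" for f :: "'a \<Rightarrow> real" and c
    unfolding iso_gaussian_def p_def by (subst integral_density) auto
  have p_int: "integrable lborel (\<lambda>z. p c z * f z)"
    if [measurable]: "f \<in> borel_measurable borel" and "\<And>z. \<bar>f z\<bar> \<le> 1" for f :: "'a \<Rightarrow> real" and c
  proof -
    interpret prob_space "iso_gaussian c v" by (rule prob_space_iso_gaussian[OF v])
    have "integrable (iso_gaussian c v) f"
      by (rule integrable_const_bound[of _ 1]) (auto simp: that)
    then show ?thesis
      unfolding iso_gaussian_def p_def by (subst (asm) integrable_density) auto
  qed
  have "(\<integral>z. h z \<partial>iso_gaussian b v) = (\<integral>z. h (\<rho> z) \<partial>iso_gaussian a v)"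
    by (rule swap_int) measurable
  then have D: "(\<integral>z. h z \<partial>iso_gaussian a v) - (\<integral>z. h z \<partial>iso_gaussian b v) = (\<integral>z. k z \<partial>iso_gaussian a v)"
    unfolding k_def
    by (subst Bochner_Integration.integral_diff)
       (auto intro!: Pa.integrable_const_bound[of _ 1] simp: h)
  have kb_int: "(\<integral>z. k z \<partial>iso_gaussian b v) = - (\<integral>z. k z \<partial>iso_gaussian a v)"
    by (subst swap_int) (simp_all add: k\<rho>)
  have gb_int: "(\<integral>z. g (2 * t z) \<partial>iso_gaussian b v) = - (\<integral>z. g (2 * t z) \<partial>iso_gaussian a v)"
    by (subst swap_int) (simp_all add: t\<rho> g_odd)
  have "(\<integral>z. p a z * k z \<partial>lborel) - (\<integral>z. p b z * k z \<partial>lborel) = (\<integral>z. (p a z - p b z) * k z \<partial>lborel)"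
    by (simp add: left_diff_distrib Bochner_Integration.integral_diff p_int kb)
  also have "\<dots> \<le> (\<integral>z. (p a z - p b z) * g (2 * t z) \<partial>lborel)"
  proof (rule integral_mono)
    show "integrable lborel (\<lambda>z. (p a z - p b z) * k z)"
      by (simp add: left_diff_distrib p_int kb)
    show "integrable lborel (\<lambda>z. (p a z - p b z) * g (2 * t z))"
      by (simp add: left_diff_distrib p_int g_bdd)
    \<comment> \<open>On the side of \<open>b\<close> both the weight and g (2 t) are negative, so
      the lower bound k \<ge> - g (2 |t|) is the one that counts there.\<close>
    show "(p a z - p b z) * k z \<le> (p a z - p b z) * g (2 * t z)" for z
    proof (cases "0 \<le> t z")
      case True
      then show ?thesis using p_le[of z] kg[of z] by (intro mult_left_mono) auto
    next
      case False
      then show ?thesis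
        using p_le[of z] kg[of z] g_odd[of "2 * t z"] by (intro mult_left_mono_neg) auto
    qed
  qed
  also have "\<dots> = (\<integral>z. p a z * g (2 * t z) \<partial>lborel) - (\<integral>z. p b z * g (2 * t z) \<partial>lborel)"
    by (simp add: left_diff_distrib Bochner_Integration.integral_diff p_int g_bdd)
  \<comment> \<open>By oddness the integrals under N(b, v I) are the negatives of those under N(a, v
    I), so each difference is twice the integral under N(a, v I).\<close>
  finally have "(\<integral>z. k z \<partial>iso_gaussian a v) \<le> (\<integral>z. g (2 * t z) \<partial>iso_gaussian a v)"
    using kb_int gb_int by (simp add: dens)
  also have "(\<integral>z. g (2 * t z) \<partial>iso_gaussian a v)
      = (\<integral>u. g (2 * (u - m \<bullet> e)) \<partial>distr (iso_gaussian a v) borel (\<lambda>z. z \<bullet> e))"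
    by (subst integral_distr) (auto simp: t_def inner_diff_left)
  also have "distr (iso_gaussian a v) borel (\<lambda>z. z \<bullet> e) = normal_measure (a \<bullet> e) (sqrt v)"
    by (rule distr_iso_gaussian_inner[OF v e1])
  also have "(\<integral>u. g (2 * (u - m \<bullet> e)) \<partial>normal_measure (a \<bullet> e) (sqrt v))
      = (\<integral>u. g (2 * u) \<partial>distr (normal_measure (a \<bullet> e) (sqrt v)) borel (\<lambda>u. - (m \<bullet> e) + 1 * u))"
    by (subst integral_distr) auto
  also have "distr (normal_measure (a \<bullet> e) (sqrt v)) borel (\<lambda>u. - (m \<bullet> e) + 1 * u)
      = normal_measure ((a - m) \<bullet> e) (sqrt v)"
    using v by (subst normal_measure_affine) (auto simp: inner_diff_left)
  also have "(a - m) \<bullet> e = dist a b / 2"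
  proof -
    have "a - m = (1/2) *\<^sub>R (a - b)" by (simp add: m_def algebra_simps) (simp add: scaleR_add_left[symmetric])
    then show ?thesis
      using r by (simp add: e_def dist_norm power2_norm_eq_inner[symmetric] power2_eq_square)
  qed
  finally show ?thesis using D by simp
qed

lemma iso_gaussian_smoothing:
  fixes a b :: "'a::euclidean_space" and h :: "'a \<Rightarrow> real" and g :: "real \<Rightarrow> real"
  assumes v: "0 < v" and ab: "a \<noteq> b"
    and [measurable]: "h \<in> borel_measurable borel" "g \<in> borel_measurable borel"
    and h: "\<And>x. 0 \<le> h x" "\<And>x. h x \<le> 1"
    and g: "\<And>r. g (- r) = - g r" "\<And>r. \<bar>g r\<bar> \<le> 1"
    and hg: "\<And>x y. \<bar>h x - h y\<bar> \<le> g (dist x y)"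
  shows "\<bar>(\<integral>z. h z \<partial>iso_gaussian a v) - (\<integral>z. h z \<partial>iso_gaussian b v)\<bar>
       \<le> (\<integral>u. g (2 * u) \<partial>normal_measure (dist a b / 2) (sqrt v))"
  using iso_gaussian_smoothing_aux[of v a b h g] iso_gaussian_smoothing_aux[of v b a h g] assms
  by (simp add: dist_commute)

text \<open>An indicator oscillates by at most 1 at positive distance, which is the odd modulus sgn,
  the limit of the family as c tends to infinity.\<close>

lemma iso_gaussian_measure_diff:
  fixes a b :: "'a::euclidean_space"
  assumes v: "0 < v" and [measurable]: "A \<in> sets borel"
  shows "\<bar>measure (iso_gaussian a v) A - measure (iso_gaussian b v) A\<bar>
       \<le> 1 - 2 * std_normal_cdf (- (dist a b / sqrt (4 * v)))"
proof (cases "a = b")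
  case True
  then show ?thesis by (simp add: std_normal_cdf_0)
next
  case False
  interpret N: prob_space "normal_measure (dist a b / 2) (sqrt v)"
    using v by (intro prob_space_normal_density) simp
  have "\<bar>(\<integral>z. indicator A z \<partial>iso_gaussian a v) - (\<integral>z. indicator A z \<partial>iso_gaussian b v)\<bar>
      \<le> (\<integral>u. sgn (2 * u) \<partial>normal_measure (dist a b / 2) (sqrt v))"
    using v False
    by (intro iso_gaussian_smoothing) (auto simp: sgn_if indicator_def)
  \<comment> \<open>The two integrands differ only at 0, where sgn is 0 and the other is -1; a
    single point is a null set.\<close>
  also have "\<dots> \<le> (\<integral>u. 1 - 2 * indicator {..0} u \<partial>normal_measure (dist a b / 2) (sqrt v))"
  proof (rule integral_mono_AE)
    show "AE u in normal_measure (dist a b / 2) (sqrt v). sgn (2 * u) \<le> 1 - 2 * indicator {..0::real} u"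
    proof -
      have "AE u in lborel. u \<noteq> (0::real)" by (rule AE_lborel_singleton)
      then have "AE u in lborel. 0 < ennreal (normal_density (dist a b / 2) (sqrt v) u) \<longrightarrow> u \<noteq> 0"
        by eventually_elim simp
      then have "AE u in normal_measure (dist a b / 2) (sqrt v). u \<noteq> 0"
        by (subst AE_density) simp_all
      then show ?thesis by eventually_elim (auto simp: sgn_if)
    qed
  qed (auto intro!: N.integrable_const_bound[of _ 1] simp: sgn_if indicator_def)
  also have "\<dots> = 1 - 2 * measure (normal_measure (dist a b / 2) (sqrt v)) {..0}"
    by (subst Bochner_Integration.integral_diff)
       (auto simp: N.prob_space[simplified] intro!: N.integrable_const_bound[of _ 1])
  also have "\<dots> = 1 - 2 * std_normal_cdf (- (dist a b / sqrt (4 * v)))"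
    using v by (subst measure_normal_atMost) (auto simp: real_sqrt_mult)
  finally show ?thesis by simp
qed

text \<open>Evaluated at 2u the modulus has slope 2c. Averaging over u with mean
  \<open>dist a b / 2\<close> and variance v gives the slope c / sqrt (1 + (2c)^2 v) in
  \<open>dist a b\<close>, so the family of moduli is preserved.\<close>

lemma iso_gaussian_smoothing_cdf:
  fixes a b :: "'a::euclidean_space" and h :: "'a \<Rightarrow> real"
  assumes v: "0 < v" and c: "0 \<le> c"
    and [measurable]: "h \<in> borel_measurable borel"
    and h: "\<And>x. 0 \<le> h x" "\<And>x. h x \<le> 1"
    and hc: "\<And>x y. \<bar>h x - h y\<bar> \<le> 1 - 2 * std_normal_cdf (- (c * dist x y))"
  shows "\<bar>(\<integral>z. h z \<partial>iso_gaussian a v) - (\<integral>z. h z \<partial>iso_gaussian b v)\<bar>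
       \<le> 1 - 2 * std_normal_cdf (- (c / sqrt (1 + 4 * c\<^sup>2 * v) * dist a b))"
proof (cases "a = b")
  case True
  then show ?thesis by (simp add: std_normal_cdf_0)
next
  case False
  interpret N: prob_space "normal_measure (dist a b / 2) (sqrt v)"
    using v by (intro prob_space_normal_density) simp
  have "\<bar>(\<integral>z. h z \<partial>iso_gaussian a v) - (\<integral>z. h z \<partial>iso_gaussian b v)\<bar>
      \<le> (\<integral>u. 1 - 2 * std_normal_cdf (- (c * (2 * u))) \<partial>normal_measure (dist a b / 2) (sqrt v))"
    using std_normal_cdf_bounds
    by (intro iso_gaussian_smoothing v False h hc) (auto simp: std_normal_cdf_uminus abs_le_iff)
  also have "\<dots> = 1 - 2 * (\<integral>u. std_normal_cdf (- ((2 * c) * u)) \<partial>normal_measure (dist a b / 2) (sqrt v))"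
    by (subst Bochner_Integration.integral_diff)
       (auto simp: N.prob_space[simplified] std_normal_cdf_bounds mult_ac intro!: N.integrable_const_bound[of _ 1])
  also have "\<dots> = 1 - 2 * std_normal_cdf (- (c / sqrt (1 + 4 * c\<^sup>2 * v) * dist a b))"
    using v c by (subst integral_std_normal_cdf_normal) (auto simp: power_mult_distrib)
  finally show ?thesis .
qed

section \<open>Contraction of the gradient step\<close>

lemma GDERIV_line:
  fixes U :: "'a::real_inner \<Rightarrow> real"
  assumes "\<And>x. GDERIV U x :> gradU x"
  shows "((\<lambda>t. U (y + t *\<^sub>R v)) has_real_derivative gradU (y + t *\<^sub>R v) \<bullet> v) (at t)"
proof -
  have "((\<lambda>t. U (y + t *\<^sub>R v)) has_derivative (\<lambda>h. (h *\<^sub>R v) \<bullet> gradU (y + t *\<^sub>R v))) (at t)"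
    using assms[of "y + t *\<^sub>R v"] unfolding gderiv_def
    by (rule has_derivative_compose[rotated]) (auto intro!: derivative_eq_intros)
  then show ?thesis
    unfolding has_field_derivative_def by (rule has_derivative_eq_rhs) (auto simp: inner_commute)
qed

text \<open>Along the segment from y to z, \<open>U\<close> minus its quadratic upper model has
  nonpositive derivative, by Cauchy-Schwarz and the Lipschitz bound.\<close>

lemma descent_lemma:
  fixes U :: "'a::real_inner \<Rightarrow> real"
  assumes grad: "\<And>x. GDERIV U x :> gradU x"
    and lip: "\<And>x y. norm (gradU x - gradU y) \<le> L * norm (x - y)"
  shows "U z \<le> U y + gradU y \<bullet> (z - y) + L / 2 * (norm (z - y))\<^sup>2"
proof -
  define v where "v = z - y"
  define f where "f t = U (y + t *\<^sub>R v) - t * (gradU y \<bullet> v) - L / 2 * t\<^sup>2 * (norm v)\<^sup>2" for t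
  have "f 1 \<le> f 0"
  proof (rule DERIV_nonpos_imp_nonincreasing[of 0 1 f])
    fix t :: real assume t: "0 \<le> t" "t \<le> 1"
    let ?d = "gradU (y + t *\<^sub>R v) \<bullet> v - gradU y \<bullet> v - L * t * (norm v)\<^sup>2"
    have "(f has_real_derivative ?d) (at t)"
      unfolding f_def by (rule derivative_eq_intros GDERIV_line[OF grad] refl | simp)+
    moreover have "?d \<le> 0"
    proof -
      have "gradU (y + t *\<^sub>R v) \<bullet> v - gradU y \<bullet> v \<le> norm (gradU (y + t *\<^sub>R v) - gradU y) * norm v"
        unfolding inner_diff_left[symmetric] by (rule norm_cauchy_schwarz)
      also have "\<dots> \<le> (L * norm (t *\<^sub>R v)) * norm v"
        using lip[of "y + t *\<^sub>R v" y] by (intro mult_right_mono) auto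
      finally show ?thesis using t by (simp add: power2_eq_square mult_ac)
    qed
    ultimately show "\<exists>d. (f has_real_derivative d) (at t) \<and> d \<le> 0" by blast
  qed simp
  then show ?thesis by (simp add: f_def v_def)
qed

locale strongly_convex_smooth =
  fixes U :: "'a::euclidean_space \<Rightarrow> real" and gradU :: "'a \<Rightarrow> 'a" and L m :: real
  assumes grad: "\<And>x. GDERIV U x :> gradU x"
    and cont_grad: "continuous_on UNIV gradU"
    and m: "m > 0"
    and lipschitz: "\<And>x y. norm (gradU x - gradU y) \<le> L * norm (x - y)"
    and strongly_convex: "\<And>x y. U y \<ge> U x + gradU x \<bullet> (y - x) + (m / 2) * (norm (x - y))\<^sup>2"
begin

abbreviation "\<kappa> \<equiv> kappa m L"

lemma gradU_monotone: "m * (norm (x - y))\<^sup>2 \<le> (gradU x - gradU y) \<bullet> (x - y)"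
  using strongly_convex[of x y] strongly_convex[of y x]
  by (simp add: norm_minus_commute inner_diff_left inner_diff_right)

lemma m_le_L: "m \<le> L"
proof -
  obtain b :: 'a where b: "b \<in> Basis" using nonempty_Basis by blast
  have "m \<le> (gradU b - gradU 0) \<bullet> b" using gradU_monotone[of b 0] b by simp
  also have "\<dots> \<le> norm (gradU b - gradU 0) * norm b" by (rule norm_cauchy_schwarz)
  also have "\<dots> \<le> L" using lipschitz[of b 0] b by simp
  finally show ?thesis .
qed

lemma kappa_pos: "0 < \<kappa>"
  using m m_le_L by (simp add: kappa_def)

text \<open>Subtracting (m/2) |z|^2 from \<open>U\<close> leaves a convex function with a quadratic
  upper bound of constant L - m. The claim is the Baillon-Haddad cocoercivity of its gradient,
  rewritten for \<open>gradU\<close>.\<close>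

lemma cocoercive:
  "(norm (gradU x - gradU y))\<^sup>2 + m * L * (norm (x - y))\<^sup>2 \<le> (m + L) * ((gradU x - gradU y) \<bullet> (x - y))"
proof (cases "m = L")
  case True
  \<comment> \<open>Here L - m = 0 and cannot be divided by; the Lipschitz bound and strong
    monotonicity share the constant m and are simply added.\<close>
  have "(norm (gradU x - gradU y))\<^sup>2 \<le> (m * norm (x - y))\<^sup>2"
    using lipschitz[of x y] True by (intro power_mono) auto
  moreover have "2 * m * (m * (norm (x - y))\<^sup>2) \<le> 2 * m * ((gradU x - gradU y) \<bullet> (x - y))"
    using gradU_monotone m by (intro mult_left_mono) auto
  ultimately show ?thesis using True by (simp add: power_mult_distrib power2_eq_square algebra_simps)
next
  case False
  define K where "K = L - m"
  have K: "0 < K" using False m_le_L by (simp add: K_def)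
  define dphi where "dphi z = gradU z - m *\<^sub>R z" for z
  define phi where "phi z = U z - m / 2 * (norm z)\<^sup>2" for z
  have lower: "phi z \<ge> phi w + dphi w \<bullet> (z - w)" for z w
    using strongly_convex[of w z]
    by (simp add: phi_def dphi_def power2_norm_eq_inner inner_diff_left inner_diff_right inner_commute algebra_simps
        add_divide_distrib diff_divide_distrib)
  have upper: "phi z \<le> phi w + dphi w \<bullet> (z - w) + K / 2 * (norm (z - w))\<^sup>2" for z w
    using descent_lemma[OF grad lipschitz, of z w]
    by (simp add: phi_def dphi_def K_def power2_norm_eq_inner inner_diff_left inner_diff_right inner_commute algebra_simps
        add_divide_distrib diff_divide_distrib)
  have half: "(norm (dphi w - dphi z))\<^sup>2 / (2 * K) \<le> phi w - phi z - dphi z \<bullet> (w - z)" for w z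
  proof -
    define D where "D = dphi w - dphi z"
    \<comment> \<open>The point w - D/K minimizes the quadratic upper bound, taken at w, of phi
      minus its linear part at z.\<close>
    have "phi z + dphi z \<bullet> (w - (1/K) *\<^sub>R D - z) \<le> phi (w - (1/K) *\<^sub>R D)"
      by (rule lower)
    also have "\<dots> \<le> phi w + dphi w \<bullet> (- (1/K) *\<^sub>R D) + K / 2 * (norm (- (1/K) *\<^sub>R D))\<^sup>2"
      using upper[of "w - (1/K) *\<^sub>R D" w] by simp
    finally have *: "(1/K) * (D \<bullet> D) - K / 2 * (norm (- (1/K) *\<^sub>R D))\<^sup>2 \<le> phi w - phi z - dphi z \<bullet> (w - z)"
      by (simp add: D_def inner_diff_left inner_diff_right inner_commute algebra_simps diff_divide_distrib)
    have "(norm (- (1/K) *\<^sub>R D))\<^sup>2 = (norm D)\<^sup>2 / K\<^sup>2"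
      by (simp add: power_mult_distrib power_divide)
    then have "(1/K) * (D \<bullet> D) - K / 2 * (norm (- (1/K) *\<^sub>R D))\<^sup>2 = (norm D)\<^sup>2 / (2 * K)"
      using K by (simp add: power2_norm_eq_inner[symmetric] field_simps power2_eq_square)
    with * show ?thesis by (simp add: D_def)
  qed
  \<comment> \<open>The inequality \<open>half\<close> is added to itself with x and y exchanged,
    which cancels the values of phi.\<close>
  have "(norm (dphi x - dphi y))\<^sup>2 / K \<le> (dphi x - dphi y) \<bullet> (x - y)"
    using half[of x y] half[of y x] K
    by (simp add: norm_minus_commute inner_diff_left inner_diff_right field_simps)
  then have "(norm (dphi x - dphi y))\<^sup>2 \<le> K * ((dphi x - dphi y) \<bullet> (x - y))"
    using K by (simp add: field_simps)
  moreover define w G where "w = x - y" and "G = gradU x - gradU y"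
  have "dphi x - dphi y = G - m *\<^sub>R w"
    by (simp add: dphi_def w_def G_def algebra_simps)
  ultimately have "(norm (G - m *\<^sub>R w))\<^sup>2 \<le> K * ((G - m *\<^sub>R w) \<bullet> w)"
    by (simp add: w_def)
  moreover have "(norm (G - m *\<^sub>R w))\<^sup>2 = (norm G)\<^sup>2 - 2 * m * (G \<bullet> w) + m * m * (norm w)\<^sup>2"
    unfolding power2_norm_eq_inner
    by (simp add: inner_diff_left inner_diff_right inner_commute algebra_simps)
  moreover have "(G - m *\<^sub>R w) \<bullet> w = G \<bullet> w - m * (norm w)\<^sup>2"
    unfolding power2_norm_eq_inner by (simp add: inner_diff_left)
  ultimately have "(norm G)\<^sup>2 + m * L * (norm w)\<^sup>2 \<le> (m + L) * (G \<bullet> w)"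
    by (simp add: K_def algebra_simps power2_norm_eq_inner inner_commute[of w G])
  then show ?thesis by (simp add: w_def G_def)
qed

text \<open>At the largest step \<kappa> g = 4 m L / (m + L)^2, which the arithmetic-geometric mean
  inequality bounds by 1. The value 1 is attained for m = L, so the contraction factor can be
  0.\<close>

lemma step_size_bounds:
  assumes "0 < g" "g \<le> 2 / (m + L)"
  shows "0 \<le> 1 - \<kappa> * g" "1 - \<kappa> * g < 1"
proof -
  have "\<kappa> * g \<le> 2 * m * L / (m + L) * (2 / (m + L))"
    unfolding kappa_def using assms m m_le_L by (intro mult_left_mono) auto
  also have "\<dots> = 4 * m * L / (m + L)\<^sup>2" by (simp add: power2_eq_square)
  also have "\<dots> \<le> 1"
  proof -
    have "4 * m * L \<le> (m + L)\<^sup>2" using zero_le_power2[of "m - L"] by (simp add: power2_eq_square algebra_simps)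
    then show ?thesis using m m_le_L by (simp add: divide_le_eq)
  qed
  finally show "0 \<le> 1 - \<kappa> * g" by simp
  show "1 - \<kappa> * g < 1" using kappa_pos assms by simp
qed

text \<open>After expanding the square, g \<le> 2/(m + L) is used on one factor of g^2 |G|^2.
  Cocoercivity then cancels the terms in |G|^2 exactly and leaves 1 - \<kappa> g.\<close>

lemma gradient_step_contraction:
  assumes g: "0 < g" "g \<le> 2 / (m + L)"
  shows "dist (x - g *\<^sub>R gradU x) (y - g *\<^sub>R gradU y) \<le> sqrt (1 - \<kappa> * g) * dist x y"
proof (rule power2_le_imp_le)
  define w where "w = x - y"
  define G where "G = gradU x - gradU y"
  have mL: "0 < m + L" using m m_le_L by simp
  have diff: "x - g *\<^sub>R gradU x - (y - g *\<^sub>R gradU y) = w - g *\<^sub>R G" by (simp add: w_def G_def algebra_simps)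
  have "(dist (x - g *\<^sub>R gradU x) (y - g *\<^sub>R gradU y))\<^sup>2 = (norm w)\<^sup>2 - 2 * g * (G \<bullet> w) + g * (g * (norm G)\<^sup>2)"
    unfolding dist_norm diff power2_norm_eq_inner
    by (simp add: inner_diff_left inner_diff_right inner_commute algebra_simps)
  also have "\<dots> \<le> (norm w)\<^sup>2 - 2 * g * (G \<bullet> w) + g * (2 / (m + L) * (norm G)\<^sup>2)"
    using g by (intro add_left_mono mult_left_mono mult_right_mono) auto
  also have "\<dots> \<le> (norm w)\<^sup>2 - 2 * g * (((norm G)\<^sup>2 + m * L * (norm w)\<^sup>2) / (m + L)) + g * (2 / (m + L) * (norm G)\<^sup>2)"
  proof -
    have "((norm G)\<^sup>2 + m * L * (norm w)\<^sup>2) / (m + L) \<le> G \<bullet> w"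
      using cocoercive[of x y] mL by (simp add: G_def w_def divide_le_eq mult.commute)
    then have "2 * g * (((norm G)\<^sup>2 + m * L * (norm w)\<^sup>2) / (m + L)) \<le> 2 * g * (G \<bullet> w)"
      using g by (intro mult_left_mono) auto
    then show ?thesis by (intro add_right_mono diff_left_mono)
  qed
  also have "\<dots> = (1 - \<kappa> * g) * (norm w)\<^sup>2"
    by (simp add: kappa_def add_divide_distrib algebra_simps)
  also have "\<dots> = (sqrt (1 - \<kappa> * g) * dist x y)\<^sup>2"
    using step_size_bounds[OF g] by (simp add: power_mult_distrib w_def dist_norm)
  finally show "(dist (x - g *\<^sub>R gradU x) (y - g *\<^sub>R gradU y))\<^sup>2 \<le> (sqrt (1 - \<kappa> * g) * dist x y)\<^sup>2" .
qed (use step_size_bounds[OF g] in simp)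

text \<open>A zero of the gradient is obtained from Banach's theorem, as the fixed point of the
  drift with the largest step. Strong convexity makes it the strict minimizer, which determines the
  choice made by \<open>ARG_MIN\<close>.\<close>

lemma gradU_argmin: "gradU (ARG_MIN U z. True) = 0"
proof -
  let ?T = "\<lambda>x. x - (2 / (m + L)) *\<^sub>R gradU x"
  have g: "0 < 2 / (m + L)" "2 / (m + L) \<le> 2 / (m + L)" using m m_le_L by auto
  have "\<exists>!x. ?T x = x"
    using gradient_step_contraction[OF g] step_size_bounds[OF g]
    by (intro banach_fix_type[of "sqrt (1 - \<kappa> * (2 / (m + L)))"]) auto
  then obtain p where "?T p = p" by blast
  then have p: "gradU p = 0" using g by simp
  have "U z > U p" if "z \<noteq> p" for z
  proof -
    have "0 < m / 2 * (norm (p - z))\<^sup>2" using m that by simp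
    then show ?thesis using strongly_convex[of p z] p by simp
  qed
  then have "(ARG_MIN U z. True) = p"
    unfolding arg_min_def is_arg_min_def by (intro some_equality) (metis less_asym less_irrefl)+
  then show ?thesis using p by simp
qed

end

section \<open>Total variation bounds for composed kernels\<close>

lemma tv_dist_le:
  assumes "\<And>A. A \<in> sets borel \<Longrightarrow> \<bar>measure \<mu> A - measure \<nu> A\<bar> \<le> B"
  shows "tv_dist \<mu> \<nu> \<le> B"
  unfolding tv_dist_def using assms by (intro cSUP_least) auto

lemma measurable_iso_gaussian:
  assumes "0 < v"
  shows "(\<lambda>\<mu>. iso_gaussian \<mu> v) \<in> borel \<rightarrow>\<^sub>M prob_algebra (borel :: 'a::euclidean_space measure)"
proof (rule measurable_prob_algebraI)
  show "prob_space (iso_gaussian \<mu> v)" for \<mu> :: 'a using assms by (rule prob_space_iso_gaussian)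
  then have sub: "subprob_space (iso_gaussian \<mu> v)" for \<mu> :: 'a by (rule prob_space_imp_subprob_space)
  show "(\<lambda>\<mu>. iso_gaussian \<mu> v) \<in> borel \<rightarrow>\<^sub>M subprob_algebra (borel :: 'a measure)"
  proof (rule measurable_subprob_algebra)
    fix A :: "'a set" assume [measurable]: "A \<in> sets borel"
    show "(\<lambda>\<mu>. emeasure (iso_gaussian \<mu> v) A) \<in> borel_measurable borel"
      unfolding iso_gaussian_def by (simp add: emeasure_density)
  qed (simp_all add: sub)
qed

text \<open>A list of step sizes stands for the composed kernel, its head being the first step.\<close>

definition ula_kernels :: "('a::euclidean_space \<Rightarrow> 'a) \<Rightarrow> real list \<Rightarrow> 'a \<Rightarrow> 'a measure" where
  "ula_kernels gradU gs = foldr kernel_comp (map (ula_kernel gradU) gs) (return borel)"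

lemma ula_kernels_Nil [simp]: "ula_kernels gradU [] = return borel"
  and ula_kernels_Cons: "ula_kernels gradU (g # gs) x = bind (ula_kernel gradU g x) (ula_kernels gradU gs)"
  by (simp_all add: ula_kernels_def kernel_comp_def)

lemma ula_kernel_prod_eq: "ula_kernel_prod gradU \<gamma> n l = ula_kernels gradU (map \<gamma> [n..<Suc l])"
  by (simp add: ula_kernel_prod_def ula_kernels_def comp_def)

lemma kernel_power_eq: "kernel_power (ula_kernel gradU g) n = ula_kernels gradU (replicate n g)"
  by (induction n) (simp_all add: kernel_power_def ula_kernels_def)

context strongly_convex_smooth
begin

abbreviation "Q \<equiv> ula_kernels gradU"

abbreviation admissible :: "real \<Rightarrow> bool" where
  "admissible g \<equiv> 0 < g \<and> g \<le> 2 / (m + L)"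

lemma gradU_measurable [measurable]: "gradU \<in> borel_measurable borel"
  by (rule borel_measurable_continuous_onI[OF cont_grad])

lemma measurable_ula_kernel:
  assumes "0 < g"
  shows "ula_kernel gradU g \<in> borel \<rightarrow>\<^sub>M prob_algebra borel"
  unfolding ula_kernel_def
  by (rule measurable_compose[OF _ measurable_iso_gaussian]) (use assms in auto)

lemma measurable_ula_kernels:
  "(\<And>g. g \<in> set gs \<Longrightarrow> admissible g) \<Longrightarrow> Q gs \<in> borel \<rightarrow>\<^sub>M prob_algebra borel"
proof (induction gs)
  case (Cons g gs)
  then have "(\<lambda>x. bind (ula_kernel gradU g x) (Q gs)) \<in> borel \<rightarrow>\<^sub>M prob_algebra borel"
    by (intro measurable_bind_prob_space[of _ _ borel] measurable_ula_kernel) auto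
  then show ?case by (simp add: ula_kernels_Cons[abs_def])
qed simp

lemma sets_ula_kernels [simp]:
  assumes "\<And>g. g \<in> set gs \<Longrightarrow> admissible g"
  shows "sets (Q gs x) = sets borel" "prob_space (Q gs x)"
proof -
  have "Q gs x \<in> space (prob_algebra borel)"
    by (rule measurable_space[OF measurable_ula_kernels]) (use assms in auto)
  then show "sets (Q gs x) = sets borel" "prob_space (Q gs x)"
    by (simp_all add: space_prob_algebra)
qed

lemma measurable_measure_ula_kernels:
  assumes "\<And>g. g \<in> set gs \<Longrightarrow> admissible g" "A \<in> sets borel"
  shows "(\<lambda>x. measure (Q gs x) A) \<in> borel_measurable borel"
  by (rule measure_measurable_prob_algebra2[OF _ measurable_ula_kernels[OF assms(1)]])
     (use assms(2) in simp_all)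

lemma measure_bind_ula_kernels:
  assumes "\<And>g. g \<in> set gs \<Longrightarrow> admissible g" "A \<in> sets borel" "prob_space M" "sets M = sets borel"
  shows "measure (bind M (Q gs)) A = (\<integral>z. measure (Q gs z) A \<partial>M)"
proof -
  interpret prob_space M by fact
  have Q: "Q gs \<in> M \<rightarrow>\<^sub>M subprob_algebra borel"
    using measurable_prob_algebraD[OF measurable_ula_kernels[OF assms(1)]] assms(4)
    by (simp add: measurable_cong_sets[OF assms(4) refl])
  show ?thesis by (rule measure_bind[OF Q assms(2)])
qed

lemma ula_kernels_append:
  assumes "\<And>g. g \<in> set (gs @ hs) \<Longrightarrow> admissible g"
  shows "Q (gs @ hs) x = bind (Q gs x) (Q hs)"
  using assms
proof (induction gs arbitrary: x)
  case Nil
  then show ?case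
    using measurable_prob_algebraD[OF measurable_ula_kernels[of hs]] by (simp add: bind_return)
next
  case (Cons g gs)
  have "bind (bind (ula_kernel gradU g x) (Q gs)) (Q hs) = bind (ula_kernel gradU g x) (\<lambda>y. bind (Q gs y) (Q hs))"
    using Cons.prems measurable_prob_algebraD[OF measurable_ula_kernels[of hs]]
      measurable_prob_algebraD[OF measurable_ula_kernels[of gs]]
    by (intro bind_assoc[of _ _ borel _ borel]) (simp_all add: ula_kernel_def measurable_cong_sets[OF iso_gaussian_sets refl])
  moreover have "Q (gs @ hs) = (\<lambda>y. bind (Q gs y) (Q hs))"
    using Cons by (intro ext) auto
  ultimately show ?case by (simp add: ula_kernels_Cons)
qed

section \<open>Backward recursion for the modulus of continuity\<close>

definition contraction_factor :: "real list \<Rightarrow> real" where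
  "contraction_factor gs = prod_list (map (\<lambda>g. 1 - \<kappa> * g) gs)"

lemma contraction_factor_bounds:
  assumes "gs \<noteq> []" "\<And>g. g \<in> set gs \<Longrightarrow> admissible g"
  shows "0 \<le> contraction_factor gs" "contraction_factor gs < 1"
  using assms
proof (induction gs rule: list_nonempty_induct)
  case (single g)
  {
    case 1 then show ?case using step_size_bounds[of g] by (simp add: contraction_factor_def)
  next
    case 2 then show ?case using step_size_bounds[of g] by (simp add: contraction_factor_def)
  }
next
  case (cons g gs)
  {
    case 1 then show ?case using cons step_size_bounds[of g] by (simp add: contraction_factor_def)
  next
    case 2
    then have "(1 - \<kappa> * g) * contraction_factor gs \<le> 1 * contraction_factor gs"
      using cons step_size_bounds[of g] by (intro mult_right_mono) auto
    also have "\<dots> < 1" using 2 cons by simp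
    finally show ?case by (simp add: contraction_factor_def)
  }
qed

text \<open>The tail of the list is only seen through the function z \<mapsto>
  \<open>measure (Q gs z) A\<close> and its modulus; the head smooths this function and contracts
  distances. The induction starts at singletons, since the empty product makes 1 - P vanish.\<close>

lemma ula_kernels_measure_diff:
  assumes "gs \<noteq> []" "\<And>g. g \<in> set gs \<Longrightarrow> admissible g" and A: "A \<in> sets borel"
  shows "\<bar>measure (Q gs x) A - measure (Q gs y) A\<bar>
       \<le> 1 - 2 * std_normal_cdf
             (- (sqrt (\<kappa> * contraction_factor gs / (8 * (1 - contraction_factor gs))) * dist x y))"
  using assms(1,2)
proof (induction gs arbitrary: x y rule: list_nonempty_induct)
  case (single g)
  then have g: "0 < g" "g \<le> 2 / (m + L)" by auto
  have Q: "Q [g] z = iso_gaussian (z - g *\<^sub>R gradU z) (2 * g)" for z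
    by (simp add: ula_kernels_Cons ula_kernel_def bind_return'')
  have "dist (x - g *\<^sub>R gradU x) (y - g *\<^sub>R gradU y) / sqrt (4 * (2 * g))
      \<le> sqrt (1 - \<kappa> * g) * dist x y / sqrt (8 * g)"
    using gradient_step_contraction[OF g] g by (simp add: divide_right_mono)
  \<comment> \<open>Inserting \<kappa> on both sides of the fraction brings out 1 - P = \<kappa>
    g.\<close>
  also have "\<dots> = sqrt (\<kappa> * (1 - \<kappa> * g) / (8 * (\<kappa> * g))) * dist x y"
    using kappa_pos by (simp add: real_sqrt_divide)
  finally have "std_normal_cdf (- (sqrt (\<kappa> * (1 - \<kappa> * g) / (8 * (\<kappa> * g))) * dist x y))
      \<le> std_normal_cdf (- (dist (x - g *\<^sub>R gradU x) (y - g *\<^sub>R gradU y) / sqrt (4 * (2 * g))))"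
    by (intro std_normal_cdf_mono) simp
  then show ?case
    using iso_gaussian_measure_diff[of "2 * g" A "x - g *\<^sub>R gradU x" "y - g *\<^sub>R gradU y"] g A
    by (simp add: Q contraction_factor_def)
next
  case (cons g gs)
  then have g: "0 < g" "g \<le> 2 / (m + L)" and gs: "\<And>h. h \<in> set gs \<Longrightarrow> admissible h" by auto
  define P where "P = contraction_factor gs"
  define c where "c = sqrt (\<kappa> * P / (8 * (1 - P)))"
  define q where "q = 1 - \<kappa> * g"
  have P: "0 \<le> P" "P < 1" using contraction_factor_bounds[OF cons(1) gs] by (auto simp: P_def)
  have q: "0 \<le> q" "q < 1" using step_size_bounds[OF g] by (auto simp: q_def)
  have cf: "contraction_factor (g # gs) = q * P" by (simp add: contraction_factor_def P_def q_def)
  have "q * P \<le> 1 * P" using P q by (intro mult_right_mono) auto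
  then have qP: "q * P < 1" using P by simp
  have Q: "measure (Q (g # gs) z) A = (\<integral>w. measure (Q gs w) A \<partial>iso_gaussian (z - g *\<^sub>R gradU z) (2 * g))" for z
    unfolding ula_kernels_Cons ula_kernel_def
    using g by (intro measure_bind_ula_kernels gs A prob_space_iso_gaussian) auto
  have c0: "0 \<le> c" using P kappa_pos by (simp add: c_def)
  have "c / sqrt (1 + 4 * c\<^sup>2 * (2 * g)) * sqrt q = sqrt (\<kappa> * (q * P) / (8 * (1 - q * P)))"
  proof -
    have c2: "c\<^sup>2 = \<kappa> * P / (8 * (1 - P))" using P kappa_pos by (simp add: c_def)
    \<comment> \<open>With \<kappa> g = 1 - q the numerator is 1 - P + P (1 - q) = 1 - q P, so the
      closed form in P reproduces itself without loss.\<close>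
    have "1 + 4 * c\<^sup>2 * (2 * g) = (1 - q * P) / (1 - P)"
      using P by (simp add: c2 q_def field_simps)
    then have "c / sqrt (1 + 4 * c\<^sup>2 * (2 * g)) * sqrt q
        = sqrt (\<kappa> * P / (8 * (1 - P)) / ((1 - q * P) / (1 - P)) * q)"
      by (simp only: c_def real_sqrt_divide real_sqrt_mult)
    also have "\<kappa> * P / (8 * (1 - P)) / ((1 - q * P) / (1 - P)) * q = \<kappa> * (q * P) / (8 * (1 - q * P))"
    proof -
      have "a / (8 * r) / (s / r) * q = a * q / (8 * s)" if "0 < r" for a r s :: real
        using that by (simp add: field_simps)
      from this[of "1 - P" "\<kappa> * P" "1 - q * P"] show ?thesis using P by (simp only: mult_ac diff_gt_0_iff_gt)
    qed
    finally show ?thesis .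
  qed
  moreover have "c / sqrt (1 + 4 * c\<^sup>2 * (2 * g)) * dist (x - g *\<^sub>R gradU x) (y - g *\<^sub>R gradU y)
      \<le> c / sqrt (1 + 4 * c\<^sup>2 * (2 * g)) * (sqrt q * dist x y)"
    unfolding q_def using g c0 by (intro mult_left_mono gradient_step_contraction) auto
  ultimately have "c / sqrt (1 + 4 * c\<^sup>2 * (2 * g)) * dist (x - g *\<^sub>R gradU x) (y - g *\<^sub>R gradU y)
      \<le> sqrt (\<kappa> * (q * P) / (8 * (1 - q * P))) * dist x y"
    by (simp only: mult.assoc[symmetric])
  then have "std_normal_cdf (- (sqrt (\<kappa> * (q * P) / (8 * (1 - q * P))) * dist x y))
     \<le> std_normal_cdf (- (c / sqrt (1 + 4 * c\<^sup>2 * (2 * g)) * dist (x - g *\<^sub>R gradU x) (y - g *\<^sub>R gradU y)))"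
    by (intro std_normal_cdf_mono) simp
  moreover have "\<bar>measure (Q (g # gs) x) A - measure (Q (g # gs) y) A\<bar>
      \<le> 1 - 2 * std_normal_cdf (- (c / sqrt (1 + 4 * c\<^sup>2 * (2 * g)) * dist (x - g *\<^sub>R gradU x) (y - g *\<^sub>R gradU y)))"
    unfolding Q
  proof (rule iso_gaussian_smoothing_cdf)
    show "measure (Q gs x) A \<le> 1" for x using prob_space.prob_le_1[OF sets_ula_kernels(2)[OF gs]] .
    show "\<bar>measure (Q gs x) A - measure (Q gs y) A\<bar> \<le> 1 - 2 * std_normal_cdf (- (c * dist x y))" for x y
      unfolding c_def P_def by (rule cons.IH[OF gs])
  qed (use g c0 gs A in \<open>auto intro: measurable_measure_ula_kernels\<close>)
  ultimately show ?case unfolding cf by linarith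
qed

text \<open>Linearising the normal distribution function turns 1/(8\<Lambda>) into 1/(4 pi
  \<Lambda>). A modulus linear in the distance is what integrates against a coupling to give
  \<open>W1\<close>.\<close>

lemma ula_kernels_Lipschitz:
  assumes "gs \<noteq> []" "\<And>g. g \<in> set gs \<Longrightarrow> admissible g" "A \<in> sets borel"
  shows "\<bar>measure (Q gs x) A - measure (Q gs y) A\<bar>
       \<le> sqrt (\<kappa> * contraction_factor gs / (4 * pi * (1 - contraction_factor gs))) * dist x y"
proof -
  define P where "P = contraction_factor gs"
  have P: "0 \<le> P" "P < 1" using contraction_factor_bounds[OF assms(1,2)] by (auto simp: P_def)
  have "\<bar>measure (Q gs x) A - measure (Q gs y) A\<bar>
      \<le> 2 * (sqrt (\<kappa> * P / (8 * (1 - P))) * dist x y) / sqrt (2 * pi)"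
    unfolding P_def
    using P kappa_pos P_def
    by (intro order_trans[OF ula_kernels_measure_diff[OF assms] std_normal_cdf_Lipschitz]) auto
  also have "\<dots> = sqrt 4 * sqrt (\<kappa> * P / (8 * (1 - P))) / sqrt (2 * pi) * dist x y"
    by simp
  also have "sqrt 4 * sqrt (\<kappa> * P / (8 * (1 - P))) / sqrt (2 * pi) = sqrt (4 * (\<kappa> * P / (8 * (1 - P))) / (2 * pi))"
    by (simp only: real_sqrt_divide real_sqrt_mult)
  also have "4 * (\<kappa> * P / (8 * (1 - P))) / (2 * pi) = \<kappa> * P / (4 * pi * (1 - P))"
    using P by (simp add: field_simps)
  finally show ?thesis by (simp add: P_def)
qed

end

section \<open>Moments and setwise limits\<close>

text \<open>Two random variables on one space serve both uses: the projections of a coupling, and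
  the identity against a constant for the comparison with a Dirac mass.\<close>

lemma expectation_Lipschitz:
  fixes X Y :: "'b \<Rightarrow> 'a::euclidean_space" and h :: "'a \<Rightarrow> real"
  assumes Z: "prob_space Z"
    and [measurable]: "X \<in> Z \<rightarrow>\<^sub>M borel" "Y \<in> Z \<rightarrow>\<^sub>M borel" "h \<in> borel_measurable borel"
    and h: "\<And>x. 0 \<le> h x" "\<And>x. h x \<le> 1"
    and C: "0 \<le> C" and lip: "\<And>x y. \<bar>h x - h y\<bar> \<le> C * dist x y"
  shows "ennreal \<bar>(\<integral>z. h (X z) \<partial>Z) - (\<integral>z. h (Y z) \<partial>Z)\<bar> \<le> ennreal C * (\<integral>\<^sup>+z. ennreal (dist (X z) (Y z)) \<partial>Z)"
proof -
  interpret prob_space Z by fact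
  have int: "integrable Z (\<lambda>z. h (X z))" "integrable Z (\<lambda>z. h (Y z))"
    by (auto intro!: integrable_const_bound[of _ 1] simp: h)
  then have "ennreal \<bar>(\<integral>z. h (X z) \<partial>Z) - (\<integral>z. h (Y z) \<partial>Z)\<bar> = ennreal (norm (\<integral>z. h (X z) - h (Y z) \<partial>Z))"
    by simp
  also have "\<dots> \<le> (\<integral>\<^sup>+z. ennreal (norm (h (X z) - h (Y z))) \<partial>Z)"
    using int by (intro integral_norm_bound_ennreal) auto
  also have "\<dots> \<le> (\<integral>\<^sup>+z. ennreal C * ennreal (dist (X z) (Y z)) \<partial>Z)"
    using lip C by (intro nn_integral_mono) (simp add: ennreal_mult[symmetric])
  also have "\<dots> = ennreal C * (\<integral>\<^sup>+z. ennreal (dist (X z) (Y z)) \<partial>Z)"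
    by (rule nn_integral_cmult) measurable
  finally show ?thesis .
qed

lemma first_moment_le_second:
  fixes p :: "'a::euclidean_space"
  assumes M: "prob_space M" "sets M = sets borel" and B: "0 < B"
    and le: "(\<integral>\<^sup>+z. ennreal ((dist z p)\<^sup>2) \<partial>M) \<le> ennreal B"
  shows "(\<integral>\<^sup>+z. ennreal (dist z p) \<partial>M) \<le> ennreal (sqrt B)"
proof -
  interpret prob_space M by fact
  note [measurable_cong] = M(2)
  define s where "s = sqrt B"
  have s: "0 < s" "s\<^sup>2 = B" using B by (auto simp: s_def)
  \<comment> \<open>The arithmetic-geometric mean inequality, linear in t^2 and sharp at t = s =
    sqrt B; integrating it replaces Jensen's inequality.\<close>
  have "t \<le> 1 / (2 * s) * t\<^sup>2 + s / 2" for t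
    using s zero_le_power2[of "t - s"] by (simp add: field_simps power2_eq_square)
  then have "(\<integral>\<^sup>+z. ennreal (dist z p) \<partial>M)
      \<le> (\<integral>\<^sup>+z. ennreal (1 / (2 * s)) * ennreal ((dist z p)\<^sup>2) + ennreal (s / 2) \<partial>M)"
    using s by (intro nn_integral_mono) (auto simp: ennreal_mult[symmetric] ennreal_plus[symmetric] simp del: ennreal_plus intro!: ennreal_leI)
  also have "\<dots> = ennreal (1 / (2 * s)) * (\<integral>\<^sup>+z. ennreal ((dist z p)\<^sup>2) \<partial>M) + ennreal (s / 2)"
    by (subst nn_integral_add) (auto simp: nn_integral_cmult emeasure_space_1)
  also have "\<dots> \<le> ennreal (1 / (2 * s)) * ennreal B + ennreal (s / 2)"
    by (intro add_right_mono mult_left_mono le) auto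
  also have "\<dots> = ennreal (sqrt B)"
    using s by (simp add: ennreal_mult[symmetric] ennreal_plus[symmetric] power2_eq_square del: ennreal_plus flip: s(2) s_def)
  finally show ?thesis .
qed

text \<open>The inequality for the complement is the reverse inequality. This turns the one-sided
  bounds that survive a setwise limit into equality.\<close>

lemma prob_space_eqI_le:
  assumes "prob_space M" "prob_space N" "sets M = sets N"
    and le: "\<And>A. A \<in> sets N \<Longrightarrow> measure M A \<le> measure N A"
  shows "M = N"
proof (rule measure_eqI)
  interpret M: prob_space M by fact
  interpret N: prob_space N by fact
  fix A assume A: "A \<in> sets M"
  have "measure M (space M - A) \<le> measure N (space N - A)"
    using le[of "space N - A"] A assms(3) by (simp add: sets_eq_imp_space_eq[OF assms(3)])
  then have "measure N A \<le> measure M A"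
    using A assms(3) by (simp add: M.prob_compl N.prob_compl)
  with le[of A] A assms(3) show "emeasure M A = emeasure N A"
    by (simp add: M.emeasure_eq_measure N.emeasure_eq_measure)
qed fact

text \<open>Completeness in total variation. The bound \<open>u n\<close> is uniform in the event,
  and this uniformity is what carries countable additivity over to the limit.\<close>

lemma setwise_Cauchy_limit:
  fixes M :: "nat \<Rightarrow> 'a measure"
  assumes prob: "\<And>n. prob_space (M n)" and sets: "\<And>n. sets (M n) = sets N"
    and cauchy: "\<And>n k A. A \<in> sets N \<Longrightarrow> \<bar>measure (M (n + k)) A - measure (M n) A\<bar> \<le> u n"
    and u: "u \<longlonglongrightarrow> 0"
  obtains \<pi> where "prob_space \<pi>" "sets \<pi> = sets N"
    "\<And>A. A \<in> sets N \<Longrightarrow> (\<lambda>n. measure (M n) A) \<longlonglongrightarrow> measure \<pi> A"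
proof -
  interpret M: prob_space "M n" for n by (rule prob)
  define l where "l A = lim (\<lambda>n. measure (M n) A)" for A
  have conv: "(\<lambda>n. measure (M n) A) \<longlonglongrightarrow> l A" if A: "A \<in> sets N" for A
  proof -
    have "Cauchy (\<lambda>n. measure (M n) A)"
    proof (rule CauchyI')
      fix e :: real assume "0 < e"
      from order_tendstoD(2)[OF u this] obtain n0 where n0: "\<And>n. n0 \<le> n \<Longrightarrow> u n < e"
        by (auto simp: eventually_sequentially)
      have "dist (measure (M m) A) (measure (M n) A) < e" if "n0 \<le> m" "m < n" for m n
        using cauchy[OF A, of m "n - m"] n0[of m] that by (simp add: dist_real_def abs_minus_commute)
      then show "\<exists>n0. \<forall>m\<ge>n0. \<forall>n>m. dist (measure (M m) A) (measure (M n) A) < e" by blast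
    qed
    then show ?thesis unfolding l_def by (simp add: Cauchy_convergent_iff convergent_LIMSEQ_iff)
  qed
  have close: "\<bar>l A - measure (M n) A\<bar> \<le> u n" if A: "A \<in> sets N" for A n
  proof (rule LIMSEQ_le_const2)
    have "(\<lambda>k. measure (M (n + k)) A) \<longlonglongrightarrow> l A"
      using LIMSEQ_ignore_initial_segment[OF conv[OF A], of n] by (simp add: add.commute)
    then show "(\<lambda>k. \<bar>measure (M (n + k)) A - measure (M n) A\<bar>) \<longlonglongrightarrow> \<bar>l A - measure (M n) A\<bar>"
      by (intro tendsto_intros)
  qed (use cauchy[OF A] in auto)
  have l0: "0 \<le> l A" if "A \<in> sets N" for A
    by (rule LIMSEQ_le_const[OF conv[OF that]]) auto
  have space: "space (M n) = space N" for n by (rule sets_eq_imp_space_eq[OF sets])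
  define \<pi> where "\<pi> = measure_of (space N) (sets N) (\<lambda>A. ennreal (l A))"
  have l_empty: "l {} = 0" using conv[of "{}"] by (simp add: LIMSEQ_const_iff)
  have pos: "positive (sets N) (\<lambda>A. ennreal (l A))" by (simp add: positive_def l_empty)
  have "countably_additive (sets N) (\<lambda>A. ennreal (l A))"
  proof (rule sets.empty_continuous_imp_countably_additive[OF pos])
    show "additive (sets N) (\<lambda>A. ennreal (l A))"
      unfolding additive_def
    proof (intro ballI impI)
      fix A B assume AB: "A \<in> sets N" "B \<in> sets N" "A \<inter> B = {}"
      have "(\<lambda>n. measure (M n) (A \<union> B)) \<longlonglongrightarrow> l A + l B"
        using tendsto_add[OF conv[OF AB(1)] conv[OF AB(2)]] AB sets by (simp add: M.finite_measure_Union)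
      then have "l (A \<union> B) = l A + l B" using conv[of "A \<union> B"] AB by (metis LIMSEQ_unique sets.Un)
      then show "ennreal (l (A \<union> B)) = ennreal (l A) + ennreal (l B)" using AB l0 by (simp add: ennreal_plus)
    qed
    show "\<forall>A\<in>sets N. ennreal (l A) \<noteq> \<infinity>" by simp
    fix A :: "nat \<Rightarrow> 'a set" assume A: "range A \<subseteq> sets N" "decseq A" "(\<Inter>i. A i) = {}"
    have "(\<lambda>i. l (A i)) \<longlonglongrightarrow> 0"
    proof (rule LIMSEQ_I)
      fix e :: real assume e: "0 < e"
      from order_tendstoD(2)[OF u, of "e / 2"] e obtain n where n: "u n < e / 2"
        by (auto simp: eventually_sequentially)
      \<comment> \<open>With n fixed by uniformity, only the continuity from above of the single
        measure \<open>M n\<close> is used.\<close>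
      have "(\<lambda>i. measure (M n) (A i)) \<longlonglongrightarrow> measure (M n) (\<Inter>i. A i)"
        using A sets by (intro M.finite_Lim_measure_decseq) auto
      then have "(\<lambda>i. measure (M n) (A i)) \<longlonglongrightarrow> 0" by (simp add: A(3))
      from order_tendstoD(2)[OF this, of "e / 2"] e obtain i0 where i0: "\<And>i. i0 \<le> i \<Longrightarrow> measure (M n) (A i) < e / 2"
        by (auto simp: eventually_sequentially)
      have "norm (l (A i) - 0) < e" if "i0 \<le> i" for i
        using close[of "A i" n] l0[of "A i"] i0[OF that] n A(1) by (auto simp: abs_le_iff)
      then show "\<exists>i0. \<forall>i\<ge>i0. norm (l (A i) - 0) < e" by blast
    qed
    then show "(\<lambda>i. ennreal (l (A i))) \<longlonglongrightarrow> 0" using tendsto_ennrealI by fastforce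
  qed
  then have em: "emeasure \<pi> A = ennreal (l A)" if "A \<in> sets N" for A
    unfolding \<pi>_def using that pos sets.space_closed
    by (subst emeasure_measure_of_sigma) (auto intro: sets.sigma_algebra_axioms)
  have sets\<pi>: "sets \<pi> = sets N" by (simp add: \<pi>_def)
  have space\<pi>: "space \<pi> = space N" by (simp add: \<pi>_def)
  have "l (space N) = 1"
    using conv[of "space N"] M.prob_space by (simp add: space LIMSEQ_const_iff)
  then have "prob_space \<pi>" by (intro prob_spaceI) (simp add: em space\<pi>)
  moreover have "(\<lambda>n. measure (M n) A) \<longlonglongrightarrow> measure \<pi> A" if "A \<in> sets N" for A
    using conv[OF that] l0[OF that] by (simp add: measure_def[of \<pi>] em that)
  ultimately show thesis using sets\<pi> that by blast
qed

text \<open>Fatou's lemma for varying measures: simple functions take finitely many values, so their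
  integrals converge under setwise convergence, and the supremum over simple functions below f keeps
  the upper bound.\<close>

lemma nn_integral_setwise_limit_le:
  fixes M :: "nat \<Rightarrow> 'a measure"
  assumes "\<And>n. prob_space (M n)" "prob_space \<pi>" and sets: "\<And>n. sets (M n) = sets \<pi>"
    and conv: "\<And>A. A \<in> sets \<pi> \<Longrightarrow> (\<lambda>n. measure (M n) A) \<longlonglongrightarrow> measure \<pi> A"
    and f: "f \<in> borel_measurable \<pi>"
    and le: "\<And>n. (\<integral>\<^sup>+x. f x \<partial>M n) \<le> b n" and b: "b \<longlonglongrightarrow> B"
  shows "(\<integral>\<^sup>+x. f x \<partial>\<pi>) \<le> B"
proof -
  interpret M: prob_space "M n" for n by fact
  interpret prob_space \<pi> by fact
  have space: "space (M n) = space \<pi>" for n by (rule sets_eq_imp_space_eq[OF sets])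
  show ?thesis
    unfolding nn_integral_def_finite
  proof (rule SUP_least)
    fix s assume "s \<in> {g. simple_function \<pi> g \<and> g \<le> f \<and> (\<forall>x. g x < top)}"
    then have s: "simple_function \<pi> s" "s \<le> f" "\<And>x. s x < top" by auto
    have sM: "simple_function (M n) s" for n
      using s(1) by (simp add: simple_function_def space sets)
    have "(\<lambda>n. integral\<^sup>S (M n) s) \<longlonglongrightarrow> integral\<^sup>S \<pi> s"
      unfolding simple_integral_def space
    proof (intro tendsto_sum tendsto_mult_ennreal tendsto_const)
      fix y assume "y \<in> s ` space \<pi>"
      then have "y < top" using s(3) by auto
      then show "\<not> (y = 0 \<and> emeasure \<pi> (s -` {y} \<inter> space \<pi>) = \<infinity> \<or> y = \<infinity> \<and> emeasure \<pi> (s -` {y} \<inter> space \<pi>) = 0)"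
        by (simp add: emeasure_eq_measure)
      have "s -` {y} \<inter> space \<pi> \<in> sets \<pi>" using s(1) by (rule simple_functionD)
      from conv[OF this]
      show "(\<lambda>n. emeasure (M n) (s -` {y} \<inter> space \<pi>)) \<longlonglongrightarrow> emeasure \<pi> (s -` {y} \<inter> space \<pi>)"
        by (simp add: M.emeasure_eq_measure emeasure_eq_measure tendsto_ennrealI)
    qed
    moreover have "integral\<^sup>S (M n) s \<le> b n" for n
    proof -
      have "integral\<^sup>S (M n) s = (\<integral>\<^sup>+x. s x \<partial>M n)" by (rule nn_integral_eq_simple_integral[OF sM, symmetric])
      also have "\<dots> \<le> (\<integral>\<^sup>+x. f x \<partial>M n)" using s(2) by (intro nn_integral_mono) (auto simp: le_fun_def)
      finally show ?thesis using le[of n] by (rule order_trans)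
    qed
    ultimately show "integral\<^sup>S \<pi> s \<le> B" using b by (intro LIMSEQ_le) auto
  qed
qed

section \<open>Wasserstein bound and stationary distribution\<close>

context strongly_convex_smooth
begin

text \<open>This is (4 pi \<Lambda>)^(-1/2) written in terms of P, with value 0 when some factor of
  P vanishes.\<close>

abbreviation Lipschitz_factor :: "real list \<Rightarrow> real" where
  "Lipschitz_factor gs \<equiv> sqrt (\<kappa> * contraction_factor gs / (4 * pi * (1 - contraction_factor gs)))"

lemma Lipschitz_factor_nonneg:
  assumes "gs \<noteq> []" "\<And>g. g \<in> set gs \<Longrightarrow> admissible g"
  shows "0 \<le> Lipschitz_factor gs"
  using contraction_factor_bounds[OF assms] kappa_pos by simp

lemma ula_kernels_expectation_diff:
  assumes "gs \<noteq> []" "\<And>g. g \<in> set gs \<Longrightarrow> admissible g" "A \<in> sets borel"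
    and Z: "prob_space Z" and "X \<in> Z \<rightarrow>\<^sub>M borel" "Y \<in> Z \<rightarrow>\<^sub>M borel"
  shows "ennreal \<bar>(\<integral>z. measure (Q gs (X z)) A \<partial>Z) - (\<integral>z. measure (Q gs (Y z)) A \<partial>Z)\<bar>
       \<le> ennreal (Lipschitz_factor gs) * (\<integral>\<^sup>+z. ennreal (dist (X z) (Y z)) \<partial>Z)"
  by (rule expectation_Lipschitz[OF Z assms(5,6) measurable_measure_ula_kernels[OF assms(2,3)]])
     (use ula_kernels_Lipschitz[OF assms(1-3)] Lipschitz_factor_nonneg[OF assms(1,2)]
        prob_space.prob_le_1[OF sets_ula_kernels(2)[OF assms(2)]] in auto)

lemma ula_kernels_W1:
  assumes gs: "gs \<noteq> []" "\<And>g. g \<in> set gs \<Longrightarrow> admissible g"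
    and \<mu>: "prob_space \<mu>" "sets \<mu> = sets borel" and \<nu>: "prob_space \<nu>" "sets \<nu> = sets borel"
  shows "ennreal (tv_dist (bind \<mu> (Q gs)) (bind \<nu> (Q gs))) \<le> ennreal (Lipschitz_factor gs) * W1 \<mu> \<nu>"
proof -
  define C where "C = Lipschitz_factor gs"
  have C: "0 \<le> C" using Lipschitz_factor_nonneg[OF gs] by (simp add: C_def)
  have bound: "ennreal \<bar>measure (bind \<mu> (Q gs)) A - measure (bind \<nu> (Q gs)) A\<bar> \<le> ennreal C * W1 \<mu> \<nu>"
    if A: "A \<in> sets borel" for A
  proof -
    define h where "h x = measure (Q gs x) A" for x
    have h_meas [measurable]: "h \<in> borel_measurable borel"
      unfolding h_def by (rule measurable_measure_ula_kernels[OF gs(2) A])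
    have h_int: "measure (bind M (Q gs)) A = (\<integral>z. h z \<partial>M)" if "prob_space M" "sets M = sets borel" for M
      unfolding h_def by (rule measure_bind_ula_kernels[OF gs(2) A that])
    show ?thesis
    proof (cases "C = 0")
      case True
      \<comment> \<open>A vanishing factor makes the kernel forget its starting point, so the two
        images agree on A whatever \<open>W1\<close> is.\<close>
      have "\<bar>h x - h 0\<bar> \<le> C * dist x 0" for x
        unfolding h_def C_def by (rule ula_kernels_Lipschitz[OF gs A])
      then have "h x = h 0" for x using True by simp
      then have "(\<integral>z. h z \<partial>M) = h 0" if "prob_space M" for M :: "'a measure"
        using prob_space.prob_space[OF that] by (metis (no_types, lifting) Bochner_Integration.integral_cong
            lebesgue_integral_const mult_1 real_scaleR_def)
      then show ?thesis by (simp add: h_int \<mu> \<nu>)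
    next
      case False
      define t where "t = \<bar>(\<integral>z. h z \<partial>\<mu>) - (\<integral>z. h z \<partial>\<nu>)\<bar>"
      \<comment> \<open>Dividing by C first turns the bound for each coupling into a lower bound of
        its cost, which passes to the infimum.\<close>
      have "ennreal (t / C) \<le> W1 \<mu> \<nu>"
        unfolding W1_def
      proof (rule INF_greatest)
        fix \<zeta> assume "\<zeta> \<in> couplings \<mu> \<nu>"
        then have \<zeta>: "prob_space \<zeta>" "sets \<zeta> = sets (borel \<Otimes>\<^sub>M borel)" "distr \<zeta> borel fst = \<mu>" "distr \<zeta> borel snd = \<nu>"
          by (auto simp: couplings_def)
        note [measurable_cong] = \<zeta>(2)
        have "(\<integral>z. h z \<partial>\<mu>) = (\<integral>z. h (fst z) \<partial>\<zeta>)" "(\<integral>z. h z \<partial>\<nu>) = (\<integral>z. h (snd z) \<partial>\<zeta>)"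
          by (simp_all add: \<zeta>(3,4)[symmetric] integral_distr)
        then have le: "ennreal t \<le> ennreal C * (\<integral>\<^sup>+z. ennreal (dist (fst z) (snd z)) \<partial>\<zeta>)"
          unfolding t_def C_def h_def
          by (simp only:) (intro ula_kernels_expectation_diff gs A \<zeta>(1); measurable)
        show "ennreal (t / C) \<le> (\<integral>\<^sup>+z. ennreal (dist (fst z) (snd z)) \<partial>\<zeta>)"
        proof (cases "\<integral>\<^sup>+z. ennreal (dist (fst z) (snd z)) \<partial>\<zeta>")
          case (real i)
          then have "t \<le> C * i" using le C by (simp add: ennreal_mult[symmetric])
          then show ?thesis using real C False by (simp add: divide_le_eq mult.commute)
        qed simp
      qed
      then have "ennreal C * ennreal (t / C) \<le> ennreal C * W1 \<mu> \<nu>" by (rule mult_left_mono) simp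
      then show ?thesis
        using C False by (simp add: h_int \<mu> \<nu> t_def ennreal_mult[symmetric])
    qed
  qed
  show ?thesis
  proof (cases "ennreal C * W1 \<mu> \<nu>")
    case (real r)
    then have "tv_dist (bind \<mu> (Q gs)) (bind \<nu> (Q gs)) \<le> r"
      using bound by (intro tv_dist_le) simp
    then show ?thesis using real by (simp add: C_def ennreal_leI)
  qed (simp add: C_def)
qed

text \<open>Here 1/\<Lambda> = \<kappa> P / (1 - P). The infinite branch of \<open>Lam\<close> is
  exactly P = 0, where both sides are 0. The constant a is 8 for the Gaussian bound and 4 pi for the
  Wasserstein bound.\<close>

lemma inverse_ennsqrt_Lam:
  fixes \<gamma> :: "nat \<Rightarrow> real" and n l :: nat
  defines "P \<equiv> contraction_factor (map \<gamma> [n..<Suc l])"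
  assumes "n \<le> l" and \<gamma>: "\<And>k. n \<le> k \<Longrightarrow> k \<le> l \<Longrightarrow> admissible (\<gamma> k)" and a: "0 < a"
  shows "inverse (ennsqrt (ennreal a * Lam \<kappa> \<gamma> n l)) = ennreal (sqrt (\<kappa> * P / (a * (1 - P))))"
proof -
  have P_prod: "P = (\<Prod>j=n..l. 1 - \<kappa> * \<gamma> j)"
  proof -
    have "P = prod_list (map (\<lambda>j. 1 - \<kappa> * \<gamma> j) [n..<Suc l])"
      by (simp only: P_def contraction_factor_def map_map comp_def)
    also have "\<dots> = (\<Prod>j\<in>set [n..<Suc l]. 1 - \<kappa> * \<gamma> j)"
      by (rule prod.distinct_set_conv_list[symmetric]) (rule distinct_upt)
    finally show ?thesis by (simp only: set_upt atLeastLessThanSuc_atLeastAtMost)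
  qed
  have P: "0 \<le> P" "P < 1"
    unfolding P_def by (rule contraction_factor_bounds; use \<open>n \<le> l\<close> \<gamma> in auto)+
  show ?thesis
  proof (cases "P = 0")
    case True
    then have "\<exists>j\<in>{n..l}. \<kappa> * \<gamma> j = 1" by (auto simp: P_prod)
    then show ?thesis
      using a True by (simp add: Lam_def ennsqrt_def ennreal_mult_top)
  next
    case False
    then have "\<not> (\<exists>j\<in>{n..l}. \<kappa> * \<gamma> j = 1)" by (auto simp: P_prod)
    then have "Lam \<kappa> \<gamma> n l = ennreal (inverse \<kappa> * (inverse P - 1))"
      unfolding Lam_def P_prod by (simp add: prod_inversef[symmetric] comp_def)
    also have "inverse \<kappa> * (inverse P - 1) = (1 - P) / (\<kappa> * P)"
      using False kappa_pos by (simp add: field_simps)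
    finally have "ennreal a * Lam \<kappa> \<gamma> n l = ennreal (a * ((1 - P) / (\<kappa> * P)))"
      using a P kappa_pos by (simp add: ennreal_mult[symmetric])
    then have "ennsqrt (ennreal a * Lam \<kappa> \<gamma> n l) = ennreal (sqrt (a * ((1 - P) / (\<kappa> * P))))"
      using a P kappa_pos by (simp add: ennsqrt_def)
    moreover have "0 < sqrt (a * ((1 - P) / (\<kappa> * P)))"
      using a P kappa_pos False by simp
    ultimately have "inverse (ennsqrt (ennreal a * Lam \<kappa> \<gamma> n l)) = ennreal (inverse (sqrt (a * ((1 - P) / (\<kappa> * P)))))"
      by (simp only: inverse_ennreal)
    also have "inverse (sqrt (a * ((1 - P) / (\<kappa> * P)))) = sqrt (\<kappa> * P / (a * (1 - P)))"
      by (simp add: real_sqrt_inverse[symmetric])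
    finally show ?thesis .
  qed
qed

text \<open>The minimizer is invariant under the drift, so the squared distance to it contracts up to the
  noise contribution; \<open>2 d / \<kappa>\<close> is the fixed point of the resulting affine recursion.\<close>

lemma ula_second_moment:
  fixes g :: real
  assumes g: "admissible g" and p: "gradU p = 0"
  defines "B \<equiv> 2 * inverse \<kappa> * real DIM('a)"
  shows "(\<integral>\<^sup>+z. ennreal ((dist z p)\<^sup>2) \<partial>Q (replicate n g) x)
       \<le> ennreal ((1 - \<kappa> * g) ^ n * (dist x p)\<^sup>2 + B * (1 - (1 - \<kappa> * g) ^ n))"
proof (induction n arbitrary: x)
  case 0
  then show ?case by (simp add: nn_integral_return)
next
  case (Suc n)
  define q where "q = 1 - \<kappa> * g"
  have q: "0 \<le> q" "q < 1" using step_size_bounds[of g] g by (auto simp: q_def)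
  then have qn: "0 \<le> q ^ n" "q ^ n \<le> 1" by (auto intro: power_le_one)
  have B: "0 \<le> B" using kappa_pos by (simp add: B_def)
  have adm: "h \<in> set (replicate n g) \<Longrightarrow> admissible h" for h using g by simp
  have Q_meas: "Q (replicate n g) \<in> iso_gaussian \<mu> v \<rightarrow>\<^sub>M subprob_algebra borel" for \<mu> v
    using measurable_prob_algebraD[OF measurable_ula_kernels[OF adm]]
    by (simp add: measurable_cong_sets[OF iso_gaussian_sets refl])
  let ?T = "x - g *\<^sub>R gradU x"
  interpret prob_space "iso_gaussian ?T (2 * g)" using g by (intro prob_space_iso_gaussian) simp
  have T: "(dist ?T p)\<^sup>2 \<le> q * (dist x p)\<^sup>2"
  proof -
    have "(dist ?T p)\<^sup>2 \<le> (sqrt q * dist x p)\<^sup>2"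
      using gradient_step_contraction[of g x p] g p by (intro power_mono) (auto simp: q_def)
    then show ?thesis using q by (simp add: power_mult_distrib)
  qed
  have "(\<integral>\<^sup>+z. ennreal ((dist z p)\<^sup>2) \<partial>Q (replicate (Suc n) g) x)
      = (\<integral>\<^sup>+y. \<integral>\<^sup>+z. ennreal ((dist z p)\<^sup>2) \<partial>Q (replicate n g) y \<partial>iso_gaussian ?T (2 * g))"
    unfolding replicate_Suc ula_kernels_Cons ula_kernel_def
    by (rule nn_integral_bind[OF _ Q_meas]) measurable
  also have "\<dots> \<le> (\<integral>\<^sup>+y. ennreal (q ^ n) * ennreal ((dist y p)\<^sup>2) + ennreal (B * (1 - q ^ n)) \<partial>iso_gaussian ?T (2 * g))"
    using Suc.IH qn B
    by (intro nn_integral_mono) (simp add: q_def ennreal_mult[symmetric] ennreal_plus[symmetric] del: ennreal_plus)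
  also have "\<dots> = ennreal (q ^ n) * ennreal ((dist ?T p)\<^sup>2 + real DIM('a) * (2 * g)) + ennreal (B * (1 - q ^ n))"
    using g emeasure_space_1
    by (subst nn_integral_add)
       (auto simp: nn_integral_cmult nn_integral_iso_gaussian_second_moment)
  also have "\<dots> = ennreal (q ^ n * ((dist ?T p)\<^sup>2 + real DIM('a) * (2 * g)) + B * (1 - q ^ n))"
    using qn B g by (simp add: ennreal_mult[symmetric] ennreal_plus[symmetric] del: ennreal_plus)
  also have "\<dots> \<le> ennreal (q ^ Suc n * (dist x p)\<^sup>2 + B * (1 - q ^ Suc n))"
  proof (rule ennreal_leI)
    \<comment> \<open>B is chosen so that B (1 - q) is the noise of one step, 2 d g; the noise terms
      then telescope.\<close>
    have noise: "real DIM('a) * (2 * g) = B * (1 - q)"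
      using kappa_pos by (simp add: B_def q_def)
    have "q ^ n * ((dist ?T p)\<^sup>2 + real DIM('a) * (2 * g)) + B * (1 - q ^ n)
        = q ^ n * (dist ?T p)\<^sup>2 + B * (1 - q ^ Suc n)"
      unfolding noise by (simp add: algebra_simps)
    also have "q ^ n * (dist ?T p)\<^sup>2 \<le> q ^ n * (q * (dist x p)\<^sup>2)"
      using T qn by (intro mult_left_mono) auto
    finally show "q ^ n * ((dist ?T p)\<^sup>2 + real DIM('a) * (2 * g)) + B * (1 - q ^ n)
        \<le> q ^ Suc n * (dist x p)\<^sup>2 + B * (1 - q ^ Suc n)"
      by (simp add: mult_ac)
  qed
  finally show ?case by (simp add: q_def)
qed

text \<open>\<open>D\<close> bounds the transport cost from \<open>M\<close> to the Dirac mass at x,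
  so this is the Wasserstein estimate for one event, in real numbers.\<close>

lemma ula_kernels_expectation_point:
  assumes gs: "gs \<noteq> []" "\<And>g. g \<in> set gs \<Longrightarrow> admissible g" and A: "A \<in> sets borel"
    and M: "prob_space M" "sets M = sets borel"
    and D: "0 \<le> D" "(\<integral>\<^sup>+z. ennreal (dist z x) \<partial>M) \<le> ennreal D"
  shows "\<bar>measure (bind M (Q gs)) A - measure (Q gs x) A\<bar> \<le> Lipschitz_factor gs * D"
proof -
  interpret prob_space M by fact
  note [measurable_cong] = M(2)
  have "ennreal \<bar>(\<integral>z. measure (Q gs z) A \<partial>M) - (\<integral>z. measure (Q gs x) A \<partial>M)\<bar>
      \<le> ennreal (Lipschitz_factor gs) * (\<integral>\<^sup>+z. ennreal (dist z x) \<partial>M)"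
    by (rule ula_kernels_expectation_diff[OF gs A M(1), of "\<lambda>z. z" "\<lambda>_. x"]) measurable
  also have "\<dots> \<le> ennreal (Lipschitz_factor gs) * ennreal D"
    by (intro mult_left_mono D) simp
  finally show ?thesis
    using Lipschitz_factor_nonneg[OF gs] D(1) prob_space
    by (simp add: measure_bind_ula_kernels[OF gs(2) A M] ennreal_mult[symmetric])
qed

section \<open>Existence and uniqueness of the stationary distribution\<close>

lemma contraction_factor_replicate: "contraction_factor (replicate n g) = (1 - \<kappa> * g) ^ n"
  by (induction n) (simp_all add: contraction_factor_def)

lemma Lipschitz_factor_tendsto_0:
  assumes "admissible g"
  shows "(\<lambda>n. Lipschitz_factor (replicate n g)) \<longlonglongrightarrow> 0"
proof -
  have pow: "(\<lambda>n. (1 - \<kappa> * g) ^ n) \<longlonglongrightarrow> 0"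
    using step_size_bounds[of g] assms by (intro LIMSEQ_power_zero) auto
  have "(\<lambda>n. sqrt (\<kappa> * (1 - \<kappa> * g) ^ n / (4 * pi * (1 - (1 - \<kappa> * g) ^ n)))) \<longlonglongrightarrow> sqrt (\<kappa> * 0 / (4 * pi * (1 - 0)))"
    by (intro tendsto_real_sqrt tendsto_divide tendsto_mult tendsto_diff tendsto_const pow) auto
  then show ?thesis by (simp add: contraction_factor_replicate)
qed

lemma stationary_imp_invariant:
  assumes g: "admissible g" and \<pi>: "stationary_distribution (ula_kernel gradU g) \<pi>"
  shows "bind \<pi> (Q (replicate n g)) = \<pi>"
proof (induction n)
  case 0
  then show ?case using \<pi> by (simp add: stationary_distribution_def bind_return'')
next
  case (Suc n)
  have sets: "sets \<pi> = sets borel" and inv: "bind \<pi> (ula_kernel gradU g) = \<pi>"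
    using \<pi> by (auto simp: stationary_distribution_def)
  have "bind \<pi> (Q (replicate (Suc n) g)) = bind (bind \<pi> (ula_kernel gradU g)) (Q (replicate n g))"
    using measurable_prob_algebraD[OF measurable_ula_kernel[of g]]
      measurable_prob_algebraD[OF measurable_ula_kernels[of "replicate n g"]] g sets
    by (subst bind_assoc[of _ _ borel _ borel])
       (auto simp: ula_kernels_Cons[abs_def] measurable_cong_sets[OF sets refl])
  then show ?case by (simp add: inv Suc.IH)
qed

text \<open>Started at the minimizer, the chain has second moments bounded uniformly in time. An
  arbitrary number of earlier steps therefore moves its law only a bounded transport distance, which
  the later steps shrink to 0 in total variation.\<close>

lemma ula_stationary_exists:
  assumes g: "admissible g" and p: "gradU p = 0"
  defines "B \<equiv> 2 * inverse \<kappa> * real DIM('a)"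
  obtains \<pi> where "stationary_distribution (ula_kernel gradU g) \<pi>"
    "(\<integral>\<^sup>+z. ennreal ((dist z p)\<^sup>2) \<partial>\<pi>) \<le> ennreal B"
    "\<And>x A. A \<in> sets borel \<Longrightarrow> (\<lambda>n. measure (Q (replicate n g) x) A) \<longlonglongrightarrow> measure \<pi> A"
proof -
  have B: "0 < B" using kappa_pos by (simp add: B_def)
  have adm: "h \<in> set (replicate n g) \<Longrightarrow> admissible h" for h n using g by simp
  have Q: "prob_space (Q (replicate n g) x)" "sets (Q (replicate n g) x) = sets borel" for n x
    using sets_ula_kernels[of "replicate n g" x] g by simp_all
  \<comment> \<open>The shift by one keeps the Lipschitz factor meaningful: for zero steps its
    denominator is 0, and division by 0 would yield the false bound 0.\<close>
  define M where "M n = Q (replicate (Suc n) g) p" for n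
  have M: "prob_space (M n)" "sets (M n) = sets borel" for n
    unfolding M_def by (rule Q)+
  have second: "(\<integral>\<^sup>+z. ennreal ((dist z p)\<^sup>2) \<partial>Q (replicate n g) p) \<le> ennreal B" for n
  proof (rule order_trans[OF ula_second_moment[OF g p]])
    have "0 \<le> (1 - \<kappa> * g) ^ n" using step_size_bounds[of g] g by simp
    then have "B * (1 - (1 - \<kappa> * g) ^ n) \<le> B * 1" using B by (intro mult_left_mono) auto
    then show "ennreal ((1 - \<kappa> * g) ^ n * (dist p p)\<^sup>2 + 2 * inverse \<kappa> * real DIM('a) * (1 - (1 - \<kappa> * g) ^ n)) \<le> ennreal B"
      by (simp add: B_def ennreal_leI)
  qed
  define u where "u n = Lipschitz_factor (replicate (Suc n) g) * sqrt B" for n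
  have u: "u \<longlonglongrightarrow> 0"
    unfolding u_def using tendsto_mult_left_zero[OF LIMSEQ_Suc[OF Lipschitz_factor_tendsto_0[OF g]]] by simp
  have cauchy: "\<bar>measure (M (n + k)) A - measure (M n) A\<bar> \<le> u n" if A: "A \<in> sets borel" for n k A
  proof -
    \<comment> \<open>The k extra steps are put in front, so that both laws undergo the same last n
      + 1 steps.\<close>
    have "M (n + k) = Q (replicate k g @ replicate (Suc n) g) p"
      by (simp only: M_def replicate_add[symmetric]) (simp add: add.commute)
    also have "\<dots> = bind (Q (replicate k g) p) (Q (replicate (Suc n) g))"
      by (rule ula_kernels_append) (use g in auto)
    finally have *: "M (n + k) = bind (Q (replicate k g) p) (Q (replicate (Suc n) g))" .
    show ?thesis
      unfolding * unfolding M_def u_def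
      by (rule ula_kernels_expectation_point[OF _ _ A Q _ first_moment_le_second[OF Q B second]])
         (use B g in auto)
  qed
  obtain \<pi> where \<pi>: "prob_space \<pi>" "sets \<pi> = sets (borel :: 'a measure)"
    and conv: "\<And>A. A \<in> sets borel \<Longrightarrow> (\<lambda>n. measure (M n) A) \<longlonglongrightarrow> measure \<pi> A"
    using setwise_Cauchy_limit[OF M cauchy u] by blast
  interpret \<pi>: prob_space \<pi> by fact
  have R: "ula_kernel gradU g \<in> borel \<rightarrow>\<^sub>M prob_algebra borel" using g by (intro measurable_ula_kernel) simp
  note R_sub = measurable_prob_algebraD[OF R]
  have R\<pi>: "ula_kernel gradU g \<in> \<pi> \<rightarrow>\<^sub>M subprob_algebra borel"
    using R_sub by (simp add: measurable_cong_sets[OF \<pi>(2) refl])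
  have R_prob: "prob_space (ula_kernel gradU g z)" for z
    unfolding ula_kernel_def using g by (intro prob_space_iso_gaussian) simp
  have sets_bind\<pi>: "sets (bind \<pi> (ula_kernel gradU g)) = sets borel"
    by (rule sets_bind) (auto simp: ula_kernel_def \<pi>.not_empty)
  have prob_bind\<pi>: "prob_space (bind \<pi> (ula_kernel gradU g))"
    by (rule \<pi>.prob_space_bind[OF _ R\<pi>]) (simp add: R_prob)
  have "bind \<pi> (ula_kernel gradU g) = \<pi>"
  proof (rule prob_space_eqI_le[OF prob_bind\<pi> \<pi>(1)])
    \<comment> \<open>The integral of \<open>ula_kernel gradU g z\<close> at A under
      \<open>M n\<close> is the mass of A one step later, which tends to that under \<pi>. The limit
      lemma gives an upper bound; complements do the rest.\<close>
    fix A assume "A \<in> sets \<pi>"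
    then have A: "A \<in> sets borel" by (simp add: \<pi>(2))
    have "(\<integral>\<^sup>+z. emeasure (ula_kernel gradU g z) A \<partial>\<pi>) \<le> ennreal (measure \<pi> A)"
    proof (rule nn_integral_setwise_limit_le[OF M(1) \<pi>(1)])
      show "(\<lambda>n. measure (M n) A) \<longlonglongrightarrow> measure \<pi> A" if "A \<in> sets \<pi>" for A
        using that conv by (simp add: \<pi>(2))
      show "(\<lambda>z. emeasure (ula_kernel gradU g z) A) \<in> borel_measurable \<pi>"
        using measurable_emeasure_kernel[OF R\<pi> A] .
      show "(\<lambda>n. ennreal (measure (M (Suc n)) A)) \<longlonglongrightarrow> ennreal (measure \<pi> A)"
        by (intro tendsto_ennrealI LIMSEQ_Suc conv A)
      show "(\<integral>\<^sup>+z. emeasure (ula_kernel gradU g z) A \<partial>M n) \<le> ennreal (measure (M (Suc n)) A)" for n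
      proof -
        interpret Mn: prob_space "M n" by (rule M)
        have R1: "Q [g] = ula_kernel gradU g"
          by (auto simp: ula_kernels_Cons fun_eq_iff ula_kernel_def bind_return'')
        have "M (Suc n) = Q (replicate (Suc n) g @ [g]) p"
          by (simp add: M_def replicate_append_same)
        also have "\<dots> = bind (M n) (ula_kernel gradU g)"
          unfolding M_def R1[symmetric] by (rule ula_kernels_append) (use g in auto)
        finally have MSuc: "M (Suc n) = bind (M n) (ula_kernel gradU g)" .
        have "emeasure (M (Suc n)) A = (\<integral>\<^sup>+z. emeasure (ula_kernel gradU g z) A \<partial>M n)"
          unfolding MSuc
          by (rule emeasure_bind[OF Mn.not_empty _ A]) (simp add: measurable_cong_sets[OF M(2) refl] R_sub)
        then show ?thesis
          using prob_space.finite_measure[OF M(1)] by (simp add: finite_measure.emeasure_eq_measure)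
      qed
    qed (simp add: M \<pi>)
    also have "(\<integral>\<^sup>+z. emeasure (ula_kernel gradU g z) A \<partial>\<pi>) = emeasure (bind \<pi> (ula_kernel gradU g)) A"
      by (rule emeasure_bind[OF \<pi>.not_empty R\<pi> A, symmetric])
    finally show "measure (bind \<pi> (ula_kernel gradU g)) A \<le> measure \<pi> A"
      using prob_space.finite_measure[OF prob_bind\<pi>] by (simp add: finite_measure.emeasure_eq_measure)
  qed (simp add: sets_bind\<pi> \<pi>(2))
  then have stat: "stationary_distribution (ula_kernel gradU g) \<pi>"
    using \<pi> by (simp add: stationary_distribution_def)
  have moment: "(\<integral>\<^sup>+z. ennreal ((dist z p)\<^sup>2) \<partial>\<pi>) \<le> ennreal B"
  proof (rule nn_integral_setwise_limit_le[OF M(1) \<pi>(1), where b = "\<lambda>_. ennreal B"])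
    note [measurable_cong] = \<pi>(2)
    show "(\<lambda>z. ennreal ((dist z p)\<^sup>2)) \<in> borel_measurable \<pi>" by measurable
    show "(\<lambda>n. measure (M n) A) \<longlonglongrightarrow> measure \<pi> A" if "A \<in> sets \<pi>" for A
      using that conv by (simp add: \<pi>(2))
    show "(\<integral>\<^sup>+z. ennreal ((dist z p)\<^sup>2) \<partial>M n) \<le> ennreal B" for n
      unfolding M_def by (rule second)
  qed (simp_all add: M \<pi>)
  have "(\<lambda>n. measure (Q (replicate n g) x) A) \<longlonglongrightarrow> measure \<pi> A" if A: "A \<in> sets borel" for x A
  proof (rule LIMSEQ_imp_Suc)
    \<comment> \<open>The starting point is forgotten: the chains from x and from p merge at the
      rate of the Lipschitz factor.\<close>
    have "(\<lambda>n. measure (Q (replicate (Suc n) g) x) A - measure (M n) A) \<longlonglongrightarrow> 0"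
    proof (rule tendsto_rabs_zero_cancel, rule tendsto_sandwich[OF _ _ tendsto_const])
      show "(\<lambda>n. Lipschitz_factor (replicate (Suc n) g) * dist x p) \<longlonglongrightarrow> 0"
        using tendsto_mult_left_zero[OF LIMSEQ_Suc[OF Lipschitz_factor_tendsto_0[OF g]]] by simp
      show "\<forall>\<^sub>F n in sequentially. \<bar>measure (Q (replicate (Suc n) g) x) A - measure (M n) A\<bar>
          \<le> Lipschitz_factor (replicate (Suc n) g) * dist x p"
        unfolding M_def by (intro always_eventually allI ula_kernels_Lipschitz adm A) auto
    qed simp
    from tendsto_add[OF this conv[OF A]] show "(\<lambda>n. measure (Q (replicate (Suc n) g) x) A) \<longlonglongrightarrow> measure \<pi> A"
      by simp
  qed
  with stat moment show thesis by (rule that)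
qed

text \<open>Uniqueness: any stationary law equals its own image under n steps. By dominated
  convergence, the setwise limit from every starting point then forces it to be \<pi>, which also
  identifies the definite description.\<close>

lemma ula_stationary:
  assumes g: "admissible g" and p: "gradU p = 0"
  defines "B \<equiv> 2 * inverse \<kappa> * real DIM('a)"
  shows "stationary_distribution (ula_kernel gradU g) (ula_stationary gradU g)"
    "(\<integral>\<^sup>+z. ennreal ((dist z p)\<^sup>2) \<partial>ula_stationary gradU g) \<le> ennreal B"
proof -
  have adm: "h \<in> set (replicate n g) \<Longrightarrow> admissible h" for h n using g by simp
  obtain \<pi> where \<pi>: "stationary_distribution (ula_kernel gradU g) \<pi>"
    "(\<integral>\<^sup>+z. ennreal ((dist z p)\<^sup>2) \<partial>\<pi>) \<le> ennreal B"
    and conv: "\<And>x A. A \<in> sets borel \<Longrightarrow> (\<lambda>n. measure (Q (replicate n g) x) A) \<longlonglongrightarrow> measure \<pi> A"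
    using ula_stationary_exists[OF g p] unfolding B_def by blast
  have "\<pi>' = \<pi>" if \<pi>': "stationary_distribution (ula_kernel gradU g) \<pi>'" for \<pi>'
  proof (rule measure_eqI)
    have prob: "prob_space \<pi>" "prob_space \<pi>'" and sets: "sets \<pi> = sets borel" "sets \<pi>' = sets borel"
      using \<pi> \<pi>' by (auto simp: stationary_distribution_def)
    interpret \<pi>: prob_space \<pi> by (rule prob)
    interpret \<pi>': prob_space \<pi>' by (rule prob)
    note [measurable_cong] = sets(2)
    show "sets \<pi>' = sets \<pi>" by (simp add: sets)
    fix A assume "A \<in> sets \<pi>'"
    then have A: "A \<in> sets borel" by (simp add: sets)
    have [measurable]: "(\<lambda>z. measure (Q (replicate n g) z) A) \<in> borel_measurable borel" for n
      by (rule measurable_measure_ula_kernels[OF adm A])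
    have le_1: "measure (Q (replicate n g) z) A \<le> 1" for n z
      using prob_space.prob_le_1[OF sets_ula_kernels(2)[of "replicate n g" z]] g by simp
    have "(\<lambda>n. \<integral>z. measure (Q (replicate n g) z) A \<partial>\<pi>') \<longlonglongrightarrow> (\<integral>z. measure \<pi> A \<partial>\<pi>')"
      by (rule integral_dominated_convergence[where w="\<lambda>_. 1"])
         (use conv[OF A] le_1 in auto)
    moreover have "(\<integral>z. measure (Q (replicate n g) z) A \<partial>\<pi>') = measure \<pi>' A" for n
      using measure_bind_ula_kernels[of "replicate n g", OF _ A prob(2) sets(2)]
        stationary_imp_invariant[OF g \<pi>', of n] g by simp
    ultimately have "(\<lambda>n. measure \<pi>' A) \<longlonglongrightarrow> measure \<pi> A"
      using \<pi>'.prob_space by simp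
    then show "emeasure \<pi>' A = emeasure \<pi> A"
      by (simp add: LIMSEQ_const_iff \<pi>.emeasure_eq_measure \<pi>'.emeasure_eq_measure)
  qed
  then have "ula_stationary gradU g = \<pi>"
    unfolding ula_stationary_def using \<pi>(1) by (intro the_equality)
  with \<pi> show "stationary_distribution (ula_kernel gradU g) (ula_stationary gradU g)"
    "(\<integral>\<^sup>+z. ennreal ((dist z p)\<^sup>2) \<partial>ula_stationary gradU g) \<le> ennreal B"
    by simp_all
qed

text \<open>By invariance both laws are images under the same n steps, so the mean distance from x
  under the stationary law suffices. The triangle inequality through the minimizer p bounds
  it.\<close>

lemma ula_stationary_tv_dist:
  assumes g: "admissible g" and n: "1 \<le> n" and p: "gradU p = 0"
  shows "tv_dist (ula_stationary gradU g) (Q (replicate n g) x)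
       \<le> Lipschitz_factor (replicate n g) * (dist x p + sqrt (2 * inverse \<kappa> * real DIM('a)))"
proof (rule tv_dist_le)
  fix A :: "'a set" assume A: "A \<in> sets borel"
  define B where "B = 2 * inverse \<kappa> * real DIM('a)"
  have B: "0 < B" using kappa_pos by (simp add: B_def)
  have adm: "h \<in> set (replicate n g) \<Longrightarrow> admissible h" for h using g by simp
  define \<pi> where "\<pi> = ula_stationary gradU g"
  have \<pi>: "stationary_distribution (ula_kernel gradU g) \<pi>" "(\<integral>\<^sup>+z. ennreal ((dist z p)\<^sup>2) \<partial>\<pi>) \<le> ennreal B"
    using ula_stationary[OF g p] by (simp_all add: \<pi>_def B_def)
  then have prob: "prob_space \<pi>" and sets: "sets \<pi> = sets borel"
    by (auto simp: stationary_distribution_def)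
  interpret prob_space \<pi> by fact
  note [measurable_cong] = sets
  have "(\<integral>\<^sup>+z. ennreal (dist z x) \<partial>\<pi>) \<le> (\<integral>\<^sup>+z. ennreal (dist z p) + ennreal (dist x p) \<partial>\<pi>)"
    by (intro nn_integral_mono)
       (simp add: ennreal_plus[symmetric] dist_triangle2 ennreal_leI del: ennreal_plus)
  also have "\<dots> = (\<integral>\<^sup>+z. ennreal (dist z p) \<partial>\<pi>) + ennreal (dist x p)"
    by (subst nn_integral_add) (auto simp: emeasure_space_1)
  also have "\<dots> \<le> ennreal (sqrt B) + ennreal (dist x p)"
    by (intro add_right_mono first_moment_le_second prob sets B \<pi>(2))
  also have "\<dots> = ennreal (dist x p + sqrt B)"
    using B by (simp add: ennreal_plus[symmetric] add.commute del: ennreal_plus)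
  finally have "\<bar>measure (bind \<pi> (Q (replicate n g))) A - measure (Q (replicate n g) x) A\<bar>
      \<le> Lipschitz_factor (replicate n g) * (dist x p + sqrt B)"
    using B n by (intro ula_kernels_expectation_point adm A prob sets) auto
  then show "\<bar>measure (ula_stationary gradU g) A - measure (Q (replicate n g) x) A\<bar>
      \<le> Lipschitz_factor (replicate n g) * (dist x p + sqrt (2 * inverse \<kappa> * real DIM('a)))"
    unfolding stationary_imp_invariant[OF g \<pi>(1)] unfolding \<pi>_def B_def .
qed

text \<open>With s = (1 - \<kappa> g)^(n/2) one has P = s^2, and the only loss is 1 - s^2 \<ge> 1 -
  s.\<close>

lemma Lipschitz_factor_replicate_le:
  assumes g: "admissible g" and n: "1 \<le> n"
  shows "Lipschitz_factor (replicate n g)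
       \<le> (4 * pi * inverse \<kappa> * (1 - (1 - \<kappa> * g) powr (real n / 2))) powr (- 1 / 2) * (1 - \<kappa> * g) powr (real n / 2)"
proof -
  define q where "q = 1 - \<kappa> * g"
  have q: "0 \<le> q" "q < 1" using step_size_bounds[of g] g by (auto simp: q_def)
  define s where "s = q powr (real n / 2)"
  \<comment> \<open>For q = 0 the identity relies on n \<ge> 1, since \<open>0 powr 0\<close> is 0
    but \<open>0 ^ 0\<close> is 1.\<close>
  have s2: "q ^ n = s\<^sup>2"
  proof (cases "q = 0")
    case True
    then show ?thesis using n by (simp add: s_def)
  next
    case False
    then have "s\<^sup>2 = q powr (real n)" using q by (simp add: s_def powr_power)
    then show ?thesis using q False by (simp add: powr_realpow)
  qed
  have "s < 1" using q n powr_less_mono2[of "real n / 2" q 1] by (simp add: s_def)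
  then have s: "0 \<le> s" "s < 1" by (auto simp: s_def)
  have "s\<^sup>2 \<le> s" using s by (simp add: power2_eq_square mult_left_le)
  then have "\<kappa> * s\<^sup>2 / (4 * pi * (1 - s\<^sup>2)) \<le> \<kappa> * s\<^sup>2 / (4 * pi * (1 - s))"
    using s kappa_pos by (intro divide_left_mono mult_left_mono mult_pos_pos) auto
  also have "\<dots> = s\<^sup>2 / (4 * pi * inverse \<kappa> * (1 - s))"
    using kappa_pos by (simp add: field_simps)
  finally have "sqrt (\<kappa> * s\<^sup>2 / (4 * pi * (1 - s\<^sup>2))) \<le> sqrt (s\<^sup>2 / (4 * pi * inverse \<kappa> * (1 - s)))"
    by (rule real_sqrt_le_mono)
  also have "\<dots> = s / sqrt (4 * pi * inverse \<kappa> * (1 - s))"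
    using s by (simp add: real_sqrt_divide)
  also have "\<dots> = (4 * pi * inverse \<kappa> * (1 - s)) powr (- 1 / 2) * s"
    using s kappa_pos by (simp add: powr_minus_divide powr_half_sqrt)
  finally show ?thesis
    by (simp only: contraction_factor_replicate q_def[symmetric] s2 s_def[symmetric])
qed

end

theorem theorem11:
  fixes U :: "real ^ 'd \<Rightarrow> real"
    and gradU :: "real ^ 'd \<Rightarrow> real ^ 'd"
    and L m :: real
  assumes grad: "\<And>x. GDERIV U x :> gradU x"
    and cont_grad: "continuous_on UNIV gradU"
    and L: "L \<ge> 0"
    and m: "m > 0"
    and lipschitz: "\<And>x y. norm (gradU x - gradU y) \<le> L * norm (x - y)"
    and strongly_convex:
      "\<And>x y. U y \<ge> U x + gradU x \<bullet> (y - x) + (m / 2) * (norm (x - y))\<^sup>2"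
  shows
    "(\<forall>\<gamma> :: nat \<Rightarrow> real.
        (\<forall>k\<ge>1. \<gamma> k > 0) \<longrightarrow> (\<forall>j k. 1 \<le> j \<longrightarrow> j \<le> k \<longrightarrow> \<gamma> k \<le> \<gamma> j) \<longrightarrow> \<gamma> 1 \<le> 2 / (m + L) \<longrightarrow>
        (\<forall>x y n l. 1 \<le> n \<longrightarrow> n < l \<longrightarrow>
           tv_dist (bind (return borel x) (ula_kernel_prod gradU \<gamma> n l))
                   (bind (return borel y) (ula_kernel_prod gradU \<gamma> n l))
           \<le> 1 - 2 * std_normal_cdf
                 (- enn2real (ennreal (norm (x - y)) / ennsqrt (8 * Lam (kappa m L) \<gamma> n l)))))
     \<and>
     (\<forall>\<gamma> :: nat \<Rightarrow> real.
        (\<forall>k\<ge>1. \<gamma> k > 0) \<longrightarrow> (\<forall>j k. 1 \<le> j \<longrightarrow> j \<le> k \<longrightarrow> \<gamma> k \<le> \<gamma> j) \<longrightarrow> \<gamma> 1 \<le> 2 / (m + L) \<longrightarrow>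
        (\<forall>\<mu> \<nu> n l.
           prob_space \<mu> \<longrightarrow> sets \<mu> = sets borel \<longrightarrow> integrable \<mu> norm \<longrightarrow>
           prob_space \<nu> \<longrightarrow> sets \<nu> = sets borel \<longrightarrow> integrable \<nu> norm \<longrightarrow>
           1 \<le> n \<longrightarrow> n < l \<longrightarrow>
           ennreal (tv_dist (bind \<mu> (ula_kernel_prod gradU \<gamma> n l))
                            (bind \<nu> (ula_kernel_prod gradU \<gamma> n l)))
           \<le> inverse (ennsqrt (ennreal (4 * pi) * Lam (kappa m L) \<gamma> n l)) * W1 \<mu> \<nu>))
     \<and>
     (\<forall>g :: real. 0 < g \<longrightarrow> g \<le> 2 / (m + L) \<longrightarrow>
        (\<forall>x n. 1 \<le> n \<longrightarrow>
           tv_dist (ula_stationary gradU g)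
                   (bind (return borel x) (kernel_power (ula_kernel gradU g) n))
           \<le> (4 * pi * inverse (kappa m L) * (1 - (1 - kappa m L * g) powr (real n / 2))) powr (- 1 / 2)
             * (1 - kappa m L * g) powr (real n / 2)
             * (norm (x - (ARG_MIN U z. True)) + sqrt (2 * inverse (kappa m L) * real CARD('d)))))"
proof -
  interpret strongly_convex_smooth U gradU L m
    using assms by unfold_locales auto
  have adm: "admissible (\<gamma> k)"
    if "\<forall>k\<ge>1. \<gamma> k > 0" "\<forall>j k. 1 \<le> j \<longrightarrow> j \<le> k \<longrightarrow> \<gamma> k \<le> \<gamma> j" "\<gamma> 1 \<le> 2 / (m + L)" "1 \<le> k"
    for \<gamma> :: "nat \<Rightarrow> real" and k
    using that(1)[rule_format, of k] that(2)[rule_format, of 1 k] that(3,4) by simp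
  have bind_Dirac: "bind (return borel x) (Q gs) = Q gs x" if "\<And>h. h \<in> set gs \<Longrightarrow> admissible h" for x gs
    using measurable_prob_algebraD[OF measurable_ula_kernels[OF that]] by (intro bind_return) auto
  show ?thesis
  proof (intro conjI allI impI)
    fix \<gamma> :: "nat \<Rightarrow> real" and x y :: "real ^ 'd" and n l :: nat
    assume \<gamma>: "\<forall>k\<ge>1. \<gamma> k > 0" "\<forall>j k. 1 \<le> j \<longrightarrow> j \<le> k \<longrightarrow> \<gamma> k \<le> \<gamma> j" "\<gamma> 1 \<le> 2 / (m + L)"
      and nl: "1 \<le> n" "n < l"
    note adm = adm[OF \<gamma>]
    define gs where "gs = map \<gamma> [n..<Suc l]"
    have gs: "gs \<noteq> []" "\<And>h. h \<in> set gs \<Longrightarrow> admissible h"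
      using nl adm by (auto simp: gs_def)
    define c where "c = sqrt (kappa m L * contraction_factor gs / (8 * (1 - contraction_factor gs)))"
    have c: "0 \<le> c" using contraction_factor_bounds[OF gs] kappa_pos by (simp add: c_def)
    have "inverse (ennsqrt (ennreal 8 * Lam (kappa m L) \<gamma> n l)) = ennreal c"
      unfolding c_def gs_def by (rule inverse_ennsqrt_Lam) (use nl adm in auto)
    \<comment> \<open>Division on \<open>ennreal\<close> is multiplication by the inverse, so
      infinite \<Lambda> is covered as well, with c = 0.\<close>
    then have "enn2real (ennreal (norm (x - y)) / ennsqrt (8 * Lam (kappa m L) \<gamma> n l)) = c * dist x y"
      using c by (simp add: divide_ennreal_def ennreal_mult[symmetric] dist_norm mult.commute)
    then show "tv_dist (bind (return borel x) (ula_kernel_prod gradU \<gamma> n l))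
                   (bind (return borel y) (ula_kernel_prod gradU \<gamma> n l))
           \<le> 1 - 2 * std_normal_cdf
                 (- enn2real (ennreal (norm (x - y)) / ennsqrt (8 * Lam (kappa m L) \<gamma> n l)))"
      using ula_kernels_measure_diff[OF gs]
      by (simp add: ula_kernel_prod_eq gs_def[symmetric] bind_Dirac gs tv_dist_le c_def del: upt_Suc)
  next
    fix \<gamma> :: "nat \<Rightarrow> real" and \<mu> \<nu> :: "(real ^ 'd) measure" and n l :: nat
    assume \<gamma>: "\<forall>k\<ge>1. \<gamma> k > 0" "\<forall>j k. 1 \<le> j \<longrightarrow> j \<le> k \<longrightarrow> \<gamma> k \<le> \<gamma> j" "\<gamma> 1 \<le> 2 / (m + L)"
      and \<mu>: "prob_space \<mu>" "sets \<mu> = sets borel" and \<nu>: "prob_space \<nu>" "sets \<nu> = sets borel"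
      and nl: "1 \<le> n" "n < l"
    note adm = adm[OF \<gamma>]
    have gs: "map \<gamma> [n..<Suc l] \<noteq> []" "\<And>h. h \<in> set (map \<gamma> [n..<Suc l]) \<Longrightarrow> admissible h"
      using nl adm by auto
    have "inverse (ennsqrt (ennreal (4 * pi) * Lam (kappa m L) \<gamma> n l))
        = ennreal (Lipschitz_factor (map \<gamma> [n..<Suc l]))"
      by (rule inverse_ennsqrt_Lam) (use nl adm in auto)
    then show "ennreal (tv_dist (bind \<mu> (ula_kernel_prod gradU \<gamma> n l)) (bind \<nu> (ula_kernel_prod gradU \<gamma> n l)))
           \<le> inverse (ennsqrt (ennreal (4 * pi) * Lam (kappa m L) \<gamma> n l)) * W1 \<mu> \<nu>"
      using ula_kernels_W1[OF gs \<mu> \<nu>] by (simp only: ula_kernel_prod_eq)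
  next
    fix g :: real and x :: "real ^ 'd" and n :: nat
    assume g: "0 < g" "g \<le> 2 / (m + L)" and n: "1 \<le> n"
    let ?p = "ARG_MIN U z. True"
    have "tv_dist (ula_stationary gradU g) (bind (return borel x) (kernel_power (ula_kernel gradU g) n))
        = tv_dist (ula_stationary gradU g) (Q (replicate n g) x)"
      unfolding kernel_power_eq by (subst bind_Dirac) (use g in auto)
    also have "\<dots> \<le> Lipschitz_factor (replicate n g) * (dist x ?p + sqrt (2 * inverse (kappa m L) * real DIM(real ^ 'd)))"
      using g n by (intro ula_stationary_tv_dist gradU_argmin) auto
    also have "\<dots> = Lipschitz_factor (replicate n g) * (norm (x - ?p) + sqrt (2 * inverse (kappa m L) * real CARD('d)))"
      by (simp add: dist_norm)
    also have "\<dots> \<le> (4 * pi * inverse (kappa m L) * (1 - (1 - kappa m L * g) powr (real n / 2))) powr (- 1 / 2)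
             * (1 - kappa m L * g) powr (real n / 2)
             * (norm (x - ?p) + sqrt (2 * inverse (kappa m L) * real CARD('d)))"
      using g n kappa_pos by (intro mult_right_mono Lipschitz_factor_replicate_le) auto
    finally show "tv_dist (ula_stationary gradU g) (bind (return borel x) (kernel_power (ula_kernel gradU g) n))
           \<le> (4 * pi * inverse (kappa m L) * (1 - (1 - kappa m L * g) powr (real n / 2))) powr (- 1 / 2)
             * (1 - kappa m L * g) powr (real n / 2)
             * (norm (x - ?p) + sqrt (2 * inverse (kappa m L) * real CARD('d)))" .
  qed
qed

end
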